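(* Assume there exists a topological $\mathbb Q$-algebra isomorphism $\widehat{\mathrm{per}}\colon(\mathcal Z/\zeta(2)\mathcal Z)[[t]]\to\mathcal Z_{\widehat{\mathcal A}}$ (source with the $t$-adic topology, target with the $\boldsymbol p$-adic topology) such that $\widehat{\mathrm{per}}(t)=\boldsymbol p$ and $\widehat{\mathrm{per}}(\zeta^{0,t}_{\widehat{\mathcal S}}(\mathbf k))=\zeta_{\widehat{\mathcal A}}(\mathbf k)$ for every index $\mathbf k$. Then for every index $\mathbf k$ and every integer $a$, \[\widehat{\mathrm{per}}\bigl(\zeta^{at,(a+1)t}_{\widehat{\mathcal S}}(\mathbf k)\bigr)=\zeta_{\widehat{\mathcal A}}(\mathbf k;a),\] where $\zeta^{at,(a+1)t}_{\widehat{\mathcal S}}(\mathbf k)\in(\mathcal Z/\zeta(2)\mathcal Z)[[t]]$ is obtained from $\zeta^{s,t}_{\widehat{\mathcal S}}(\mathbf k)$ by substituting $s\mapsto at$, $t\mapsto(a+1)t$. Moreover, $\zeta^{s,t}_{\widehat{\mathcal S}}(\mathbf k)$ is the unique element $X(s,t)\in(\mathcal Z/\zeta(2)\mathcal Z)[[s,t]]$ with $\widehat{\mathrm{per}}(X(at,(a+1)t))=\zeta_{\widehat{\mathcal A}}(\mathbf k;a)$ for all integers $a$.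
   Context: $s,t,T$ are commuting indeterminates. An index is a finite tuple $\mathbf{k}=(k_1,\dots,k_r)$ of positive integers ($r\ge0$), $\mathrm{dep}(\mathbf k)=r$, $\mathrm{wt}(\mathbf k)=\sum k_i$; $\mathbf{k}_{[i]}=(k_1,\dots,k_i)$, $\mathbf{k}^{[i]}=(k_{i+1},\dots,k_r)$, $\overleftarrow{\mathbf{k}}=(k_r,\dots,k_1)$; $\oplus$ is componentwise sum and $b\binom{\mathbf{k}}{\mathbf{l}}=\prod_{i}\binom{k_i+l_i-1}{l_i}$. MZVs $\zeta(\mathbf k)$ for admissible $\mathbf k$ (empty or $k_r\ge2$), $\mathcal Z$ the $\mathbb Q$-algebra they generate. $\zeta^{\bullet}(\mathbf k;T)$ is the harmonic or shuffle regularized polynomial: with $\mathfrak H=\mathbb Q\langle e_0,e_1\rangle$, $e_{\mathbf{k}}=e_1e_0^{k_1-1}\cdots e_1e_0^{k_r-1}$, $Z^\bullet_T$ the unique $\mathbb Q$-algebra homomorphism $(\mathbb Q+e_1\mathfrak H,\bullet)\to\mathbb R[T]$ with $Z^\bullet_T(e_{\mathbf k})=(-1)^{\mathrm{dep}}\zeta(\mathbf k)$ for admissible $\mathbf k$ and $Z^\bullet_T(e_1)=-T$, $\zeta^\bullet(\mathbf k;T)=(-1)^{\mathrm{dep}(\mathbf k)}Z^\bullet_T(e_{\mathbf k})$. $\zeta^{t,\bullet}_{\mathrm{shift}}(\mathbf{k};T)=\sum_{\mathbf n\in\mathbb Z_{\ge0}^{\mathrm{dep}(\mathbf k)}}b\binom{\mathbf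 k}{\mathbf n}\zeta^{\bullet}(\mathbf k\oplus\mathbf n;T)(-t)^{\mathrm{wt}(\mathbf n)}$. $\zeta^{s,t}_{\widehat{\mathcal S}}(\mathbf k)$ is the image in $(\mathcal Z/\zeta(2)\mathcal Z)[[s,t]]$ of $\sum_{i=0}^{r}(-1)^{\mathrm{wt}(\mathbf k^{[i]})}\zeta^{s,\bullet}_{\mathrm{shift}}(\mathbf k_{[i]};T)\zeta^{-t,\bullet}_{\mathrm{shift}}(\overleftarrow{\mathbf k^{[i]}};T)$ (independent of $T,\bullet$); $\zeta^{0,t}_{\widehat{\mathcal S}}(\mathbf k)$ is its value at $s=0$ (the $t$-adic symmetric MZV). Finite side: $\mathcal A_n=\bigl(\prod_p\mathbb Z/p^n\mathbb Z\bigr)/\bigl(\bigoplus_p\mathbb Z/p^n\mathbb Z\bigr)$ ($p$ over all primes), $\widehat{\mathcal A}=\varprojlim_n\mathcal A_n$ via the natural projections, $\boldsymbol p=((p\bmod p^n)_p)_n\in\widehat{\mathcal A}$. For an index $\mathbf k$ and $a\in\mathbb Z$, $\zeta_{\widehat{\mathcal A}}(\mathbf k;a)=\bigl(\bigl(\sum_{ap<n_1<\cdots<n_r<(a+1)p}n_1^{-k_1}\cdots n_r^{-k_r}\bmod p^n\bigr)_p\bigr)_n$ and $\zeta_{\widehat{\mathcal A}}(\mathbf k)=\zeta_{\widehat{\mathcal A}}(\mathbf k;0)$ (with $\zeta_{\widehat{\mathcal A}}(\varnothing)=1$). $\mathcal Z_{\widehat{\mathcal A}}$ is the topological $\mathbb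 Q$-algebra ($\boldsymbol p$-adic topology) generated by all $\zeta_{\widehat{\mathcal A}}(\mathbf k)$ and $\boldsymbol p$. *)

theory Defs
  imports "HOL-Computational_Algebra.Computational_Algebra"
begin

definition is_index :: "nat list \<Rightarrow> bool" where
  "is_index k \<longleftrightarrow> (\<forall>x\<in>set k. x \<ge> 1)"

definition admissible :: "nat list \<Rightarrow> bool" where
  "admissible k \<longleftrightarrow> is_index k \<and> (k = [] \<or> last k \<ge> 2)"

fun hsum :: "nat list \<Rightarrow> int \<Rightarrow> int \<Rightarrow> 'a::field" where
  "hsum [] lo hi = 1"
| "hsum (k # ks) lo hi = (\<Sum>n\<in>{lo<..<hi}. inverse (of_int n ^ k) * hsum ks n hi)"

text \<open>Multiple zeta value zeta(k) (meaningful for admissible k).\<close>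
definition mzv :: "nat list \<Rightarrow> real" where
  "mzv k = lim (\<lambda>N. hsum k 0 (int N))"

inductive_set mzvZ :: "real set" where
  rat: "of_rat q \<in> mzvZ"
| mzv: "admissible k \<Longrightarrow> mzv k \<in> mzvZ"
| add: "x \<in> mzvZ \<Longrightarrow> y \<in> mzvZ \<Longrightarrow> x + y \<in> mzvZ"
| mult: "x \<in> mzvZ \<Longrightarrow> y \<in> mzvZ \<Longrightarrow> x * y \<in> mzvZ"

definition z2Z :: "real set" where
  "z2Z = {mzv [2] * z | z. z \<in> mzvZ}"

definition zcong :: "real \<Rightarrow> real \<Rightarrow> bool" where
  "zcong x y \<longleftrightarrow> x - y \<in> z2Z"

text \<open>Harmonic (stuffle) product of indices, as the list of resulting indices
  (with multiplicity).\<close>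
fun stuffle :: "nat list \<Rightarrow> nat list \<Rightarrow> nat list list" where
  "stuffle [] l = [l]"
| "stuffle k [] = [k]"
| "stuffle (a # k) (b # l) =
     map (Cons a) (stuffle k (b # l)) @ map (Cons b) (stuffle (a # k) l)
     @ map (Cons (a + b)) (stuffle k l)"

text \<open>Harmonic regularised MZV polynomial zeta^*(k;T), i.e. (-1)^dep Z^*_T(e_k), characterised
  as the unique map which is multiplicative for the harmonic product, agrees with zeta on
  admissible indices and sends (1) to T (extended by 0 on non-indices).\<close>
definition zeta_reg :: "nat list \<Rightarrow> real poly" where
  "zeta_reg = (THE Z. Z [] = 1
      \<and> (\<forall>k l. is_index k \<longrightarrow> is_index l \<longrightarrow> Z k * Z l = (\<Sum>m\<leftarrow>stuffle k l. Z m))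
      \<and> (\<forall>k. admissible k \<longrightarrow> Z k = [:mzv k:])
      \<and> Z [1] = [:0, 1:]
      \<and> (\<forall>k. \<not> is_index k \<longrightarrow> Z k = 0))"

text \<open>Coefficient of t^m in sum_n b(k;n) zeta^*(k+n;T) t^(wt n), at T = 0.\<close>
definition shift_coeff :: "nat list \<Rightarrow> nat \<Rightarrow> real" where
  "shift_coeff k m = (\<Sum>ns\<in>{ns. length ns = length k \<and> sum_list ns = m}.
      (\<Prod>i<length k. of_nat ((k ! i + ns ! i - 1) choose (ns ! i)))
      * poly (zeta_reg (map2 (+) k ns)) 0)"

text \<open>Coefficient of s^u t^v in zeta^{s,t}_S(k) (representative with coefficients in Z).\<close>
definition zetaS2 :: "nat list \<Rightarrow> nat \<Rightarrow> nat \<Rightarrow> real" where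
  "zetaS2 k u v = (\<Sum>i\<le>length k.
      (-1) ^ sum_list (drop i k) * ((-1) ^ u * shift_coeff (take i k) u)
      * shift_coeff (rev (drop i k)) v)"

definition subst_line :: "(nat \<Rightarrow> nat \<Rightarrow> real) \<Rightarrow> int \<Rightarrow> real fps" where
  "subst_line X a = Abs_fps (\<lambda>m. \<Sum>u\<le>m. X u (m - u) * of_int a ^ u * (of_int a + 1) ^ (m - u))"

definition ZT :: "real fps set" where
  "ZT = {f. \<forall>i. fps_nth f i \<in> mzvZ}"

definition ts_eq :: "real fps \<Rightarrow> real fps \<Rightarrow> bool" where
  "ts_eq f g \<longleftrightarrow> (\<forall>i. zcong (fps_nth f i) (fps_nth g i))"

definition ts_close :: "nat \<Rightarrow> real fps \<Rightarrow> real fps \<Rightarrow> bool" where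
  "ts_close N f g \<longleftrightarrow> (\<forall>i<N. zcong (fps_nth f i) (fps_nth g i))"

definition padic_cong :: "nat \<Rightarrow> nat \<Rightarrow> rat \<Rightarrow> bool" where
  "padic_cong n p q \<longleftrightarrow> (case quotient_of q of (a, b) \<Rightarrow> int p ^ n dvd a \<and> \<not> int p dvd b)"

text \<open>Representatives: x n p is (a p-integral rational representing) the p-component
  of the level-n element in A_n.\<close>
type_synonym ahat = "nat \<Rightarrow> nat \<Rightarrow> rat"

definition ahat_elem :: "ahat \<Rightarrow> bool" where
  "ahat_elem x \<longleftrightarrow> (\<forall>n. eventually (\<lambda>p. prime p \<longrightarrow>
      padic_cong 0 p (x n p) \<and> padic_cong n p (x (Suc n) p - x n p)) sequentially)"

definition ahat_eq :: "ahat \<Rightarrow> ahat \<Rightarrow> bool" where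
  "ahat_eq x y \<longleftrightarrow> (\<forall>n. eventually (\<lambda>p. prime p \<longrightarrow> padic_cong n p (x n p - y n p)) sequentially)"

definition ahat_add :: "ahat \<Rightarrow> ahat \<Rightarrow> ahat" where
  "ahat_add x y = (\<lambda>n p. x n p + y n p)"

definition ahat_sub :: "ahat \<Rightarrow> ahat \<Rightarrow> ahat" where
  "ahat_sub x y = (\<lambda>n p. x n p - y n p)"

definition ahat_mul :: "ahat \<Rightarrow> ahat \<Rightarrow> ahat" where
  "ahat_mul x y = (\<lambda>n p. x n p * y n p)"

definition ahat_const :: "rat \<Rightarrow> ahat" where
  "ahat_const q = (\<lambda>n p. q)"

definition ahat_p :: ahat where
  "ahat_p = (\<lambda>n p. of_nat p)"

definition ahat_pow :: "ahat \<Rightarrow> nat \<Rightarrow> ahat" where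
  "ahat_pow x m = (\<lambda>n p. x n p ^ m)"

definition ahat_close :: "nat \<Rightarrow> ahat \<Rightarrow> ahat \<Rightarrow> bool" where
  "ahat_close m x y \<longleftrightarrow> (\<exists>z. ahat_elem z \<and> ahat_eq (ahat_sub x y) (ahat_mul (ahat_pow ahat_p m) z))"

definition zetaA :: "nat list \<Rightarrow> int \<Rightarrow> ahat" where
  "zetaA k a = (\<lambda>n p. hsum k (a * int p) ((a + 1) * int p))"

inductive_set ZA0 :: "ahat set" where
  const: "ahat_const q \<in> ZA0"
| p: "ahat_p \<in> ZA0"
| zeta: "is_index k \<Longrightarrow> zetaA k 0 \<in> ZA0"
| add: "x \<in> ZA0 \<Longrightarrow> y \<in> ZA0 \<Longrightarrow> ahat_add x y \<in> ZA0"
| mult: "x \<in> ZA0 \<Longrightarrow> y \<in> ZA0 \<Longrightarrow> ahat_mul x y \<in> ZA0"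

definition ZAhat :: "ahat set" where
  "ZAhat = {x. ahat_elem x \<and> (\<forall>m. \<exists>y\<in>ZA0. ahat_close m x y)}"

definition is_per :: "(real fps \<Rightarrow> ahat) \<Rightarrow> bool" where
  "is_per per \<longleftrightarrow>
     \<comment> \<open>maps into Z_A-hat, well defined and injective on the quotient\<close>
     (\<forall>f\<in>ZT. per f \<in> ZAhat)
   \<and> (\<forall>f\<in>ZT. \<forall>g\<in>ZT. ahat_eq (per f) (per g) \<longleftrightarrow> ts_eq f g)
     \<comment> \<open>surjective\<close>
   \<and> (\<forall>x\<in>ZAhat. \<exists>f\<in>ZT. ahat_eq (per f) x)
     \<comment> \<open>Q-algebra homomorphism\<close>
   \<and> (\<forall>f\<in>ZT. \<forall>g\<in>ZT. ahat_eq (per (f + g)) (ahat_add (per f) (per g)))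
   \<and> (\<forall>f\<in>ZT. \<forall>g\<in>ZT. ahat_eq (per (f * g)) (ahat_mul (per f) (per g)))
   \<and> (\<forall>q. ahat_eq (per (fps_const (of_rat q))) (ahat_const q))
     \<comment> \<open>continuity of per and of its inverse\<close>
   \<and> (\<forall>f\<in>ZT. \<forall>m. \<exists>N. \<forall>g\<in>ZT. ts_close N f g \<longrightarrow> ahat_close m (per f) (per g))
   \<and> (\<forall>f\<in>ZT. \<forall>N. \<exists>m. \<forall>g\<in>ZT. ahat_close m (per f) (per g) \<longrightarrow> ts_close N f g)
     \<comment> \<open>per(t) = p and per(zeta^{0,t}_S(k)) = zeta_A(k)\<close>
   \<and> ahat_eq (per fps_X) ahat_p
   \<and> (\<forall>k. is_index k \<longrightarrow> ahat_eq (per (subst_line (zetaS2 k) 0)) (zetaA k 0))"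

end

theory Submission
  imports Defs "HOL-Analysis.Harmonic_Numbers" "HOL-Real_Asymp.Real_Asymp"
begin

text \<open>Write \<open>n\<^sub>i = ap + m\<^sub>i\<close> in \<open>\<zeta>(k; a)\<close> and expand in powers of \<open>ap\<close>: this gives
  \<open>\<Sum>\<^sub>l b(k; l) (-ap)\<^bsup>wt l\<^esup> \<zeta>(k \<oplus> l; 0)\<close>. The symmetric side satisfies the same formal identity, with \<open>t\<close>
  in place of \<open>p\<close> and with no relation between MZVs involved, so \<open>per\<close> matches the two
  expansions modulo every power of \<open>p\<close>. Applying \<open>per\<close> requires coefficients in \<open>mzvZ\<close>, hence the
  existence of the harmonic regularisation, which is read off from the asymptotics of truncated
  sums in terms of harmonic numbers. Uniqueness holds because a polynomial with values in a
  rational subspace of the reals at infinitely many rational points has its coefficients there.\<close>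

section \<open>Index shifts weighted by binomial coefficients\<close>

text \<open>The slots \<open>at\<close> and \<open>(a+1)t\<close> arise as follows. At
  \<open>s = 0\<close> the prefix of an index enters unshifted and the reversed suffix carries one
  shift in \<open>t\<close>. Shifting the whole index with weight \<open>(-at)^wt\<close> produces
  exactly the \<open>s = at\<close> shift on the prefix. On the suffix, the sign
  \<open>(-1)^wt\<close> turns \<open>-at\<close> into \<open>+at\<close>, and this shift composes
  with the one already present: shifts form a one-parameter semigroup, so \<open>a\<close> and
  \<open>1\<close> add up to \<open>a + 1\<close>. The main obstacle on the transport side is that
  \<open>per\<close> is compatible only with finite sums and products, only up to
  \<open>ahat_eq\<close>, and only on \<open>ZT\<close>. The expansion is therefore cut after
  \<open>n\<close> terms at level \<open>n\<close>; what remains is \<open>t^n\<close> times a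
  series in \<open>ZT\<close>, whose image is \<open>p^n\<close> times something p-integral. The
  regularisation is given by \<open>THE\<close>, so no property of it is available before existence
  and uniqueness are both proved. The sequences of truncated sums supply a model: they satisfy the
  harmonic product exactly, for every cutoff, and \<open>T\<close> stands for the harmonic
  number.\<close>

fun shift_sum :: "nat list \<Rightarrow> nat \<Rightarrow> (nat list \<Rightarrow> 'a) \<Rightarrow> 'a::comm_ring_1" where
  "shift_sum [] m F = (if m = 0 then F [] else 0)"
| "shift_sum (k # ks) m F =
     (\<Sum>w\<le>m. of_nat ((k + w - 1) choose w) * shift_sum ks (m - w) (\<lambda>l. F ((k + w) # l)))"

lemma shift_sum_0 [simp]: "shift_sum k 0 F = F k"
  by (induction k arbitrary: F) auto

text \<open>Length, weight and positivity are all that later arguments use about a shifted index: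
  splitting positions, signs, and the range where \<open>per\<close> is known.\<close>

lemma shift_sum_cong:
  assumes "\<And>l. length l = length k \<Longrightarrow> sum_list l = sum_list k + m \<Longrightarrow>
             (is_index k \<Longrightarrow> is_index l) \<Longrightarrow> F l = G l"
  shows "shift_sum k m F = shift_sum k m G"
  using assms
proof (induction k arbitrary: m F G)
  case (Cons k ks)
  have "shift_sum ks (m - w) (\<lambda>l. F ((k + w) # l)) = shift_sum ks (m - w) (\<lambda>l. G ((k + w) # l))"
    if "w \<le> m" for w
    by (rule Cons.IH, rule Cons.prems) (use that in \<open>auto simp: is_index_def\<close>)
  then show ?case by simp
qed (auto simp: is_index_def)

lemma shift_sum_mult_left: "shift_sum k m (\<lambda>l. c * F l) = c * shift_sum k m F"
  by (induction k arbitrary: m F) (simp_all add: sum_distrib_left mult.left_commute)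

lemma shift_sum_mult_right: "shift_sum k m (\<lambda>l. F l * c) = shift_sum k m F * c"
  using shift_sum_mult_left[of k m c F] by (simp add: mult.commute)

lemma shift_sum_sum:
  "shift_sum k m (\<lambda>l. \<Sum>i\<in>A. F i l) = (\<Sum>i\<in>A. shift_sum k m (F i))"
proof (induction k arbitrary: m F)
  case (Cons k ks)
  have "shift_sum (k # ks) m (\<lambda>l. \<Sum>i\<in>A. F i l) = (\<Sum>w\<le>m. \<Sum>i\<in>A.
      of_nat ((k + w - 1) choose w) * shift_sum ks (m - w) (\<lambda>l. F i ((k + w) # l)))"
    by (simp add: Cons.IH sum_distrib_left)
  also have "\<dots> = (\<Sum>i\<in>A. shift_sum (k # ks) m (F i))"
    by (subst sum.swap) simp
  finally show ?case .
qed auto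

text \<open>Both sides run over all triples of naturals with sum \<open>m\<close>, grouped
  differently. Associativity of the product of power series provides it.\<close>

lemma triangle_sum:
  fixes f :: "nat \<Rightarrow> nat \<Rightarrow> nat \<Rightarrow> 'a::comm_monoid_add"
  shows "(\<Sum>j\<le>m. \<Sum>i\<le>j. f i (j - i) (m - j)) = (\<Sum>j\<le>m. \<Sum>i\<le>m - j. f j i (m - j - i))"
  using fps_mult_assoc_lemma[where k=m and f=f] by (simp add: atLeast0AtMost)

text \<open>The weight is a product over the entries, so the added amount is simply distributed
  between the two blocks.\<close>

lemma shift_sum_append:
  "shift_sum (k @ k') m F =
     (\<Sum>w\<le>m. shift_sum k w (\<lambda>l. shift_sum k' (m - w) (\<lambda>l'. F (l @ l'))))"
proof (induction k arbitrary: m F)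
  case Nil
  have "(\<Sum>w\<le>m. if w = 0 then shift_sum k' (m - w) F else 0) = shift_sum k' m F"
    by (subst sum.delta) auto
  then show ?case by simp
next
  case (Cons k ks)
  define f where "f = (\<lambda>w v u. of_nat ((k + w - 1) choose w) *
    shift_sum ks v (\<lambda>l. shift_sum k' u (\<lambda>l'. F ((k + w) # l @ l'))))"
  have "shift_sum ((k # ks) @ k') m F = (\<Sum>w\<le>m. \<Sum>v\<le>m - w. f w v (m - w - v))"
    by (simp add: Cons.IH sum_distrib_left f_def)
  also have "\<dots> = (\<Sum>j\<le>m. \<Sum>i\<le>j. f i (j - i) (m - j))"
    by (rule triangle_sum[symmetric])
  also have "\<dots> = (\<Sum>w\<le>m. shift_sum (k # ks) w (\<lambda>l. shift_sum k' (m - w) (\<lambda>l'. F (l @ l'))))"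
    by (simp add: f_def)
  finally show ?case .
qed

lemma shift_sum_rev: "shift_sum (rev k) m F = shift_sum k m (\<lambda>l. F (rev l))"
proof (induction k arbitrary: m F)
  case (Cons k ks)
  have single: "shift_sum [k] v (\<lambda>l'. G l') = of_nat ((k + v - 1) choose v) * G [k + v]"
    for v and G :: "nat list \<Rightarrow> 'a"
  proof -
    have "shift_sum [k] v (\<lambda>l'. G l') =
        (\<Sum>w\<le>v. if w = v then of_nat ((k + v - 1) choose v) * G [k + v] else 0)"
      unfolding shift_sum.simps by (rule sum.cong) auto
    then show ?thesis by simp
  qed
  have "shift_sum (rev (k # ks)) m F = (\<Sum>w\<le>m. of_nat ((k + (m - w) - 1) choose (m - w)) *
      shift_sum ks w (\<lambda>l. F (rev l @ [k + (m - w)])))"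
    unfolding rev.simps shift_sum_append single shift_sum_mult_left Cons.IH ..
  also have "\<dots> = (\<Sum>w\<le>m. of_nat ((k + w - 1) choose w) *
      shift_sum ks (m - w) (\<lambda>l. F (rev l @ [k + w])))"
    by (rule sum.reindex_bij_witness[of _ "\<lambda>w. m - w" "\<lambda>w. m - w"]) auto
  finally show ?case by simp
qed auto

text \<open>For \<open>k > 0\<close> both sides are the multinomial coefficient of
  \<open>k - 1\<close>, \<open>x\<close>, \<open>z - x\<close> in \<open>k + z - 1\<close>: raising
  an entry by \<open>x\<close> and then by \<open>z - x\<close> amounts to raising it by
  \<open>z\<close> and marking \<open>x\<close> of the \<open>z\<close> units.\<close>

lemma binomial_shift:
  assumes "x \<le> z"
  shows "((k + x - 1) choose x) * ((k + z - 1) choose (z - x)) = ((k + z - 1) choose z) * (z choose x)"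
\<comment> \<open>Truncated subtraction singles this case out: both sides are 0 unless
  \<open>z = 0\<close>, when both are 1.\<close>
proof (cases "k = 0")
  case True
  then show ?thesis using assms by (cases x; cases z) (auto simp: binomial_eq_0 simp del: binomial_Suc_Suc)
next
  case False
  then have "((k + z - 1) choose z) * (z choose x) = ((k + z - 1) choose x) * ((k + z - 1 - x) choose (z - x))"
    using assms by (intro choose_mult) auto
  also have "\<dots> = ((k + z - 1) choose (z - x)) * ((k + z - 1 - (z - x)) choose (z - (z - x)))"
    using assms False choose_mult[of "z - x" z "k + z - 1"] choose_mult[of x z "k + z - 1"]
    by (simp add: binomial_symmetric[of x z])
  finally show ?thesis using assms False by (simp add: mult.commute)
qed

lemma power_mult_power_diff:
  fixes a :: "'a::comm_monoid_mult"
  assumes "i \<le> x"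
  shows "a ^ i * (a ^ (x - i) * b) = a ^ x * b"
  using assms by (simp flip: power_add mult.assoc)

text \<open>Semigroup law of the shift. Entry by entry it is the binomial theorem for
  \<open>(a + 1) ^ z\<close>, once the weights of two successive shifts are merged by
  \<open>binomial_shift\<close>.\<close>

lemma shift_sum_shift_sum:
  "(\<Sum>x\<le>m. a ^ x * shift_sum k x (\<lambda>l. shift_sum l (m - x) F)) = (a + 1) ^ m * shift_sum k m F"
proof (induction k arbitrary: m F)
  case Nil
  have "(\<Sum>x\<le>m. a ^ x * shift_sum [] x (\<lambda>l. shift_sum l (m - x) F)) =
      (\<Sum>x\<le>m. if x = 0 then shift_sum [] m F else 0)"
    by (rule sum.cong) auto
  then show ?case by (simp del: shift_sum.simps) simp
next
  case (Cons k ks)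
  \<comment> \<open>\<open>c\<close> weighs two successive shifts of the first entry;
    \<open>S\<close> treats the remaining entries, with \<open>z\<close> the total by which the
    first entry has grown.\<close>
  define c where "c = (\<lambda>x y. a ^ x * of_nat ((k + x - 1) choose x) * of_nat ((k + x + y - 1) choose y))"
  define S where "S = (\<lambda>z v u. a ^ v * shift_sum ks v (\<lambda>l. shift_sum l u (\<lambda>l'. F ((k + z) # l'))))"
  have c: "(\<Sum>x\<le>z. c x (z - x)) = of_nat ((k + z - 1) choose z) * (a + 1) ^ z" for z
  proof -
    have "c x (z - x) = of_nat ((k + z - 1) choose z) * (of_nat (z choose x) * a ^ x)" if "x \<le> z" for x
    proof -
      have "c x (z - x) = a ^ x * of_nat (((k + x - 1) choose x) * ((k + z - 1) choose (z - x)))"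
        using that by (simp add: c_def mult.assoc)
      then show ?thesis unfolding binomial_shift[OF that] by (simp add: mult_ac)
    qed
    then show ?thesis
      by (simp add: binomial_ring[of a 1 z] sum_distrib_left)
  qed
  have "(\<Sum>x\<le>m. a ^ x * shift_sum (k # ks) x (\<lambda>l. shift_sum l (m - x) F)) =
      (\<Sum>x\<le>m. \<Sum>i\<le>x. \<Sum>y\<le>m - x. c i y * S (i + y) (x - i) (m - x - y))"
    by (intro sum.cong refl, simp add: shift_sum_sum shift_sum_mult_left sum_distrib_left c_def S_def)
      (intro sum.cong refl, simp add: mult_ac add_ac power_mult_power_diff)
  also have "\<dots> = (\<Sum>i\<le>m. \<Sum>j\<le>m - i. \<Sum>y\<le>m - i - j. c i y * S (i + y) j (m - i - j - y))"
    by (rule triangle_sum[of "\<lambda>i j u. \<Sum>y\<le>u. c i y * S (i + y) j (u - y)"])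
  \<comment> \<open>The second shift \<open>y\<close> of the head is moved next to its first shift
    \<open>i\<close>, past the first shift \<open>j\<close> of the tail, so that \<open>i\<close>
    and \<open>y\<close> can be merged into \<open>z\<close>.\<close>
  also have "\<dots> = (\<Sum>i\<le>m. \<Sum>y\<le>m - i. \<Sum>j\<le>m - i - y. c i y * S (i + y) j (m - i - y - j))"
  proof (rule sum.cong[OF refl])
    fix i
    have "(\<Sum>j\<le>M. \<Sum>y\<le>M - j. f j y (M - j - y)) = (\<Sum>y\<le>M. \<Sum>j\<le>M - y. f j y (M - y - j))"
      for f :: "nat \<Rightarrow> nat \<Rightarrow> nat \<Rightarrow> 'a" and M
    proof -
      have "(\<Sum>j\<le>M. \<Sum>y\<le>M - j. f j y (M - j - y)) = (\<Sum>j\<le>M. \<Sum>y\<le>j. f y (j - y) (M - j))"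
        by (rule triangle_sum[symmetric])
      also have "\<dots> = (\<Sum>j\<le>M. \<Sum>y\<le>j. f (j - y) y (M - j))"
      proof (rule sum.cong[OF refl])
        fix j
        show "(\<Sum>y\<le>j. f y (j - y) (M - j)) = (\<Sum>y\<le>j. f (j - y) y (M - j))"
          by (rule sum.reindex_bij_witness[of _ "\<lambda>w. j - w" "\<lambda>w. j - w"]) auto
      qed
      also have "\<dots> = (\<Sum>y\<le>M. \<Sum>j\<le>M - y. f j y (M - y - j))"
        by (rule triangle_sum[of "\<lambda>a b c. f b a c"])
      finally show ?thesis .
    qed
    from this[of "\<lambda>j y u. c i y * S (i + y) j u" "m - i"]
    show "(\<Sum>j\<le>m - i. \<Sum>y\<le>m - i - j. c i y * S (i + y) j (m - i - j - y)) =
      (\<Sum>y\<le>m - i. \<Sum>j\<le>m - i - y. c i y * S (i + y) j (m - i - y - j))" .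
  qed
  also have "\<dots> = (\<Sum>z\<le>m. \<Sum>i\<le>z. \<Sum>j\<le>m - z. c i (z - i) * S z j (m - z - j))"
    using triangle_sum[of "\<lambda>i y u. \<Sum>j\<le>u. c i y * S (i + y) j (u - j)" m] by simp
  also have "\<dots> = (\<Sum>z\<le>m. (\<Sum>i\<le>z. c i (z - i)) * (\<Sum>j\<le>m - z. S z j (m - z - j)))"
    by (simp add: sum_product)
  also have "\<dots> = (\<Sum>z\<le>m. of_nat ((k + z - 1) choose z) * (a + 1) ^ z *
      ((a + 1) ^ (m - z) * shift_sum ks (m - z) (\<lambda>l'. F ((k + z) # l'))))"
    unfolding c S_def Cons.IH ..
  also have "\<dots> = (\<Sum>z\<le>m. (a + 1) ^ m * (of_nat ((k + z - 1) choose z) *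
      shift_sum ks (m - z) (\<lambda>l'. F ((k + z) # l'))))"
  proof (rule sum.cong[OF refl])
    fix z assume "z \<in> {..m}"
    then have e: "(a + 1) ^ m = (a + 1) ^ z * (a + 1) ^ (m - z)"
      by (simp flip: power_add)
    show "of_nat ((k + z - 1) choose z) * (a + 1) ^ z *
      ((a + 1) ^ (m - z) * shift_sum ks (m - z) (\<lambda>l'. F ((k + z) # l'))) =
      (a + 1) ^ m * (of_nat ((k + z - 1) choose z) *
      shift_sum ks (m - z) (\<lambda>l'. F ((k + z) # l')))"
      unfolding e by (simp only: mult_ac)
  qed
  finally show ?case by (simp add: sum_distrib_left)
qed

lemma sum_fixed_length_sum_list:
  fixes f :: "nat list \<Rightarrow> 'a::comm_monoid_add"
  shows "(\<Sum>ns\<in>{ns. length ns = Suc r \<and> sum_list ns = m}. f ns) =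
    (\<Sum>w\<le>m. \<Sum>ns\<in>{ns. length ns = r \<and> sum_list ns = m - w}. f (w # ns))"
proof -
  have fin: "finite {ns :: nat list. length ns = r \<and> sum_list ns = v}" for v
    by (rule finite_subset[OF _ finite_lists_length_eq[of "{..v}" r]])
      (auto dest: member_le_sum_list)
  have "(\<Sum>w\<le>m. \<Sum>ns\<in>{ns. length ns = r \<and> sum_list ns = m - w}. f (w # ns)) =
    (\<Sum>(w, ns)\<in>(SIGMA w:{..m}. {ns. length ns = r \<and> sum_list ns = m - w}). f (w # ns))"
    by (rule sum.Sigma) (use fin in auto)
  also have "\<dots> = (\<Sum>ns\<in>{ns. length ns = Suc r \<and> sum_list ns = m}. f ns)"
    by (rule sum.reindex_bij_witness[of _ "\<lambda>ns. (hd ns, tl ns)" "\<lambda>(w, ns). w # ns"])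
      (auto simp: length_Suc_conv)
  finally show ?thesis ..
qed

text \<open>Links the recursion to the sum in \<open>shift_coeff\<close>. The recursive form, with
  \<open>F\<close> absorbing the entries already treated, allows induction on the index and serves
  real, rational and power series values alike.\<close>

lemma shift_sum_eq_sum:
  "shift_sum k m F = (\<Sum>ns\<in>{ns. length ns = length k \<and> sum_list ns = m}.
     (\<Prod>i<length k. of_nat ((k ! i + ns ! i - 1) choose (ns ! i))) * F (map2 (+) k ns))"
proof (induction k arbitrary: m F)
  case Nil
  have "{ns. length ns = 0 \<and> sum_list ns = m} = (if m = 0 then {[]} else {})" by auto
  then show ?case by (simp del: length_0_conv)
next
  case (Cons k ks)
  show ?case
    by (simp add: sum_fixed_length_sum_list Cons.IH sum_distrib_left mult.assoc prod.lessThan_Suc_shift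
        del: prod.lessThan_Suc)
qed

lemma shift_coeff_eq: "shift_coeff k m = shift_sum k m (\<lambda>l. poly (zeta_reg l) 0)"
  by (simp add: shift_coeff_def shift_sum_eq_sum)

text \<open>The symmetric counterpart of translating by \<open>ap\<close>: each cut of the index is
  shifted separately on both sides, and the suffix picks up \<open>a + 1\<close> through the
  semigroup law.\<close>

lemma zetaS2_line_shift:
  "(\<Sum>u\<le>m. zetaS2 k u (m - u) * a ^ u * (a + 1) ^ (m - u)) =
   (\<Sum>w\<le>m. (- a) ^ w * shift_sum k w (\<lambda>l. zetaS2 l 0 (m - w)))"
proof -
  define g where "g = (\<lambda>l. poly (zeta_reg l) 0)"
  have sc: "shift_coeff l v = shift_sum l v g" for l v by (simp add: shift_coeff_eq g_def)
  \<comment> \<open>The sign sees the weight of the shifted suffix, hence the extra factor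
    \<open>(-1) ^ (w - w')\<close>, which later turns \<open>-a\<close> into \<open>a\<close>
    there.\<close>
  have split: "shift_sum k w (\<lambda>l. (-1) ^ sum_list (drop i l) * g (take i l) * shift_sum (rev (drop i l)) v g) =
      (\<Sum>w'\<le>w. (-1) ^ sum_list (drop i k) * shift_sum (take i k) w' g * ((- 1) ^ (w - w') *
        shift_sum (drop i k) (w - w') (\<lambda>l. shift_sum l v (\<lambda>l'. g (rev l')))))"
    if "i \<le> length k" for i w v
  proof -
    have "shift_sum k w (\<lambda>l. (-1) ^ sum_list (drop i l) * g (take i l) * shift_sum (rev (drop i l)) v g) =
      shift_sum (take i k @ drop i k) w
        (\<lambda>l. (-1) ^ sum_list (drop i l) * g (take i l) * shift_sum (rev (drop i l)) v g)"
      by simp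
    also have "\<dots> = (\<Sum>w'\<le>w. shift_sum (take i k) w' (\<lambda>l. shift_sum (drop i k) (w - w')
       (\<lambda>l'. ((-1) ^ (sum_list (drop i k) + (w - w')) * g l) * shift_sum l' v (\<lambda>l'. g (rev l')))))"
      unfolding shift_sum_append
      by (intro sum.cong refl shift_sum_cong) (use that in \<open>simp add: shift_sum_rev\<close>)
    also have "\<dots> = (\<Sum>w'\<le>w. (-1) ^ sum_list (drop i k) * shift_sum (take i k) w' g * ((- 1) ^ (w - w') *
        shift_sum (drop i k) (w - w') (\<lambda>l. shift_sum l v (\<lambda>l'. g (rev l')))))"
      unfolding power_add mult.assoc shift_sum_mult_left shift_sum_mult_right
      by (simp add: mult_ac)
    finally show ?thesis .
  qed
  have "(\<Sum>w\<le>m. (- a) ^ w * shift_sum k w (\<lambda>l. zetaS2 l 0 (m - w))) =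
    (\<Sum>w\<le>m. (- a) ^ w * (\<Sum>i\<le>length k. shift_sum k w (\<lambda>l. (-1) ^ sum_list (drop i l) * g (take i l) *
       shift_sum (rev (drop i l)) (m - w) g)))"
    unfolding shift_sum_sum[symmetric]
    by (intro sum.cong refl arg_cong2[where f="(*)"] shift_sum_cong) (simp add: zetaS2_def sc)
  also have "\<dots> = (\<Sum>i\<le>length k. \<Sum>w\<le>m. (- a) ^ w * shift_sum k w (\<lambda>l. (-1) ^ sum_list (drop i l) * g (take i l) *
       shift_sum (rev (drop i l)) (m - w) g))"
    unfolding sum_distrib_left by (rule sum.swap)
  also have "\<dots> = (\<Sum>i\<le>length k. \<Sum>u\<le>m. (-1) ^ sum_list (drop i k) * ((-1) ^ u * shift_coeff (take i k) u)
      * shift_coeff (rev (drop i k)) (m - u) * a ^ u * (a + 1) ^ (m - u))"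
  proof (rule sum.cong[OF refl])
    fix i assume i: "i \<in> {..length k}"
    \<comment> \<open>\<open>w'\<close> is added to the prefix and \<open>w''\<close> to the suffix
      by the new shift; \<open>v\<close> is the degree of the \<open>t\<close>-shift that the suffix
      already had.\<close>
    define H where "H = (\<lambda>w' w'' v. (-1) ^ sum_list (drop i k) * ((- a) ^ w' * shift_sum (take i k) w' g) *
        (a ^ w'' * shift_sum (drop i k) w'' (\<lambda>l. shift_sum l v (\<lambda>l'. g (rev l')))))"
    have "(\<Sum>w\<le>m. (- a) ^ w * shift_sum k w (\<lambda>l. (-1) ^ sum_list (drop i l) * g (take i l) *
       shift_sum (rev (drop i l)) (m - w) g)) = (\<Sum>w\<le>m. \<Sum>w'\<le>w. H w' (w - w') (m - w))"
    proof (rule sum.cong[OF refl])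
      fix w assume "w \<in> {..m}"
      have "(- a) ^ w * ((- 1) ^ sum_list (drop i k) * A * ((- 1) ^ (w - w') * B)) =
        (- 1) ^ sum_list (drop i k) * ((- a) ^ w' * A) * (a ^ (w - w') * B)" if "w' \<le> w" for w' A B
      proof -
        have "(- a) ^ w = (- a) ^ w' * ((-1) ^ (w - w') * a ^ (w - w'))"
          using that by (simp flip: power_add power_mult_distrib)
        moreover have "(- 1) ^ (w - w') * (- 1) ^ (w - w') = (1::real)"
          by (simp flip: power_mult_distrib)
        ultimately show ?thesis by simp
      qed
      then show "(- a) ^ w * shift_sum k w (\<lambda>l. (-1) ^ sum_list (drop i l) * g (take i l) *
         shift_sum (rev (drop i l)) (m - w) g) = (\<Sum>w'\<le>w. H w' (w - w') (m - w))"
        using i unfolding split[OF i[unfolded atMost_iff]] sum_distrib_left H_def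
        by (intro sum.cong refl) simp
    qed
    also have "\<dots> = (\<Sum>u\<le>m. \<Sum>w''\<le>m - u. H u w'' (m - u - w''))"
      by (rule triangle_sum)
    also have "\<dots> = (\<Sum>u\<le>m. (-1) ^ sum_list (drop i k) * ((-1) ^ u * shift_coeff (take i k) u)
      * shift_coeff (rev (drop i k)) (m - u) * a ^ u * (a + 1) ^ (m - u))"
      unfolding H_def sum_distrib_left[symmetric] diff_diff_left[symmetric] shift_sum_shift_sum sc
        shift_sum_rev
      by (rule sum.cong[OF refl]) (simp add: power_minus[of a] mult_ac)
    finally show "(\<Sum>w\<le>m. (- a) ^ w * shift_sum k w (\<lambda>l. (-1) ^ sum_list (drop i l) * g (take i l) *
       shift_sum (rev (drop i l)) (m - w) g)) = \<dots>" .
  qed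
  also have "\<dots> = (\<Sum>u\<le>m. zetaS2 k u (m - u) * a ^ u * (a + 1) ^ (m - u))"
    unfolding zetaS2_def sum_distrib_right by (rule sum.swap)
  finally show ?thesis ..
qed

section \<open>Harmonic regularisation\<close>

lemma is_index_simps [simp]:
  "is_index []" "is_index (k # ks) \<longleftrightarrow> k \<ge> 1 \<and> is_index ks"
  "is_index (j @ l) \<longleftrightarrow> is_index j \<and> is_index l"
  by (auto simp: is_index_def)

text \<open>Pairs of smallest summation variables fall into \<open>n < m\<close>,
  \<open>n > m\<close> and \<open>n = m\<close>, which are the three branches of
  \<open>stuffle\<close>. No limit is involved, so the product rule is exact for every
  cutoff.\<close>

lemma hsum_mult:
  "(hsum k lo hi :: 'a::field) * hsum l lo hi = (\<Sum>m\<leftarrow>stuffle k l. hsum m lo hi)"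
proof (induction k l arbitrary: lo rule: stuffle.induct)
  case (3 a k b l)
  have split: "(\<Sum>n\<in>A. f n) * (\<Sum>m\<in>A. g m) =
      (\<Sum>n\<in>A. f n * (\<Sum>m\<in>{n<..<hi}. g m)) + (\<Sum>m\<in>A. g m * (\<Sum>n\<in>{m<..<hi}. f n)) + (\<Sum>n\<in>A. f n * g n)"
    if "A = {lo<..<hi}" for A and f g :: "int \<Rightarrow> 'a"
  proof -
    have "(\<Sum>n\<in>A. f n) * (\<Sum>m\<in>A. g m) = (\<Sum>n\<in>A. \<Sum>m\<in>A. f n * g m)"
      by (rule sum_product)
    also have "\<dots> = (\<Sum>n\<in>A. \<Sum>m\<in>A. (if m > n then f n * g m else 0) +
        (if n > m then f n * g m else 0) + (if n = m then f n * g m else 0))"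
      by (intro sum.cong refl) auto
    also have "\<dots> = (\<Sum>n\<in>A. \<Sum>m\<in>A. (if m > n then f n * g m else 0)) +
        (\<Sum>n\<in>A. \<Sum>m\<in>A. (if n > m then f n * g m else 0)) + (\<Sum>n\<in>A. \<Sum>m\<in>A. (if n = m then f n * g m else 0))"
      by (simp only: sum.distrib)
    also have "(\<Sum>n\<in>A. \<Sum>m\<in>A. (if n > m then f n * g m else 0)) =
        (\<Sum>m\<in>A. \<Sum>n\<in>A. (if n > m then f n * g m else 0))"
      by (rule sum.swap)
    also have "\<dots> = (\<Sum>m\<in>A. g m * (\<Sum>n\<in>{m<..<hi}. f n))"
      unfolding sum_distrib_left that
      by (rule sum.cong[OF refl], subst sum.If_cases) (auto intro!: sum.cong simp: mult.commute)
    also have "(\<Sum>n\<in>A. \<Sum>m\<in>A. (if m > n then f n * g m else 0)) =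
        (\<Sum>n\<in>A. f n * (\<Sum>m\<in>{n<..<hi}. g m))"
      unfolding sum_distrib_left that
      by (rule sum.cong[OF refl], subst sum.If_cases) (auto intro!: sum.cong)
    also have "(\<Sum>n\<in>A. \<Sum>m\<in>A. (if n = m then f n * g m else 0)) = (\<Sum>n\<in>A. f n * g n)"
      unfolding that by (intro sum.cong refl) (simp add: sum.delta)
    finally show ?thesis .
  qed
  have lin: "(\<Sum>m\<leftarrow>map (Cons c) L. hsum m lo hi :: 'a) =
      (\<Sum>n\<in>{lo<..<hi}. inverse (of_int n ^ c) * (\<Sum>m\<leftarrow>L. hsum m n hi))" for c and L
  proof (induction L)
    case (Cons x L)
    then show ?case by (simp add: distrib_left sum.distrib)
  qed auto
  have "(hsum (a # k) lo hi :: 'a) * hsum (b # l) lo hi =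
      (\<Sum>n\<in>{lo<..<hi}. inverse (of_int n ^ a) * hsum k n hi * hsum (b # l) n hi) +
      (\<Sum>n\<in>{lo<..<hi}. inverse (of_int n ^ b) * hsum l n hi * hsum (a # k) n hi) +
      (\<Sum>n\<in>{lo<..<hi}. inverse (of_int n ^ a) * hsum k n hi * (inverse (of_int n ^ b) * hsum l n hi))"
    unfolding hsum.simps by (rule split[OF refl])
  also have "\<dots> = (\<Sum>n\<in>{lo<..<hi}. inverse (of_int n ^ a) * (hsum k n hi * hsum (b # l) n hi)) +
      (\<Sum>n\<in>{lo<..<hi}. inverse (of_int n ^ b) * (hsum (a # k) n hi * hsum l n hi)) +
      (\<Sum>n\<in>{lo<..<hi}. inverse (of_int n ^ (a + b)) * (hsum k n hi * hsum l n hi))"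
    by (simp only: power_add inverse_mult_distrib mult_ac)
  also have "\<dots> = (\<Sum>m\<leftarrow>stuffle (a # k) (b # l). hsum m lo hi)"
    unfolding "3.IH" stuffle.simps map_append sum_list_append lin
    by (simp only: add.assoc)
  finally show ?case .
qed auto

text \<open>\<open>hsum\<close> peels off the smallest variable, whereas admissibility restricts the
  exponent of the largest one; this form exposes that exponent.\<close>

lemma hsum_snoc:
  "(hsum (k @ [x]) lo hi :: 'a::field) = (\<Sum>n\<in>{lo<..<hi}. inverse (of_int n ^ x) * hsum k lo n)"
proof (induction k arbitrary: lo)
  case (Cons a k)
  have "(hsum ((a # k) @ [x]) lo hi :: 'a) =
      (\<Sum>m\<in>{lo<..<hi}. \<Sum>n\<in>{m<..<hi}. inverse (of_int m ^ a) * (inverse (of_int n ^ x) * hsum k m n))"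
    unfolding append_Cons hsum.simps Cons.IH sum_distrib_left ..
  also have "\<dots> = (\<Sum>m\<in>{lo<..<hi}. \<Sum>n\<in>{lo<..<hi}.
      if m < n then inverse (of_int m ^ a) * (inverse (of_int n ^ x) * hsum k m n) else 0)"
    by (rule sum.cong[OF refl], subst sum.If_cases) (auto intro!: sum.cong)
  also have "\<dots> = (\<Sum>n\<in>{lo<..<hi}. \<Sum>m\<in>{lo<..<hi}.
      if m < n then inverse (of_int m ^ a) * (inverse (of_int n ^ x) * hsum k m n) else 0)"
    by (rule sum.swap)
  also have "\<dots> = (\<Sum>n\<in>{lo<..<hi}. \<Sum>m\<in>{lo<..<n}.
      inverse (of_int m ^ a) * (inverse (of_int n ^ x) * hsum k m n))"
    by (rule sum.cong[OF refl], subst sum.If_cases) (auto intro!: sum.cong)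
  also have "\<dots> = (\<Sum>n\<in>{lo<..<hi}. inverse (of_int n ^ x) * hsum (a # k) lo n)"
    by (simp add: sum_distrib_left mult_ac)
  finally show ?case .
qed auto

section \<open>Growth of truncated sums against harmonic numbers\<close>

definition hnum :: "nat \<Rightarrow> real" where "hnum N = hsum [1] 0 (int N)"

lemma sum_int_nat: "(\<Sum>n\<in>{0<..<int N}. f n) = (\<Sum>n\<in>{1..<N}. f (int n))"
  by (rule sum.reindex_bij_witness[of _ int nat]) auto

lemma hnum_Suc: "hnum (Suc N) = harm N"
  unfolding hnum_def hsum.simps sum_int_nat harm_def atLeastLessThanSuc_atLeastAtMost by simp

lemma hnum_nonneg: "hnum N \<ge> 0"
  unfolding hnum_def by (auto intro!: sum_nonneg)

lemma hnum_mono: "m \<le> n \<Longrightarrow> hnum m \<le> hnum n"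
  unfolding hnum_def by (auto intro!: sum_mono2)

lemma hnum_at_top: "filterlim hnum at_top sequentially"
proof -
  have "filterlim (\<lambda>N. hnum (Suc N)) at_top sequentially"
    unfolding hnum_Suc by (rule harm_at_top)
  then show ?thesis by (rule filterlim_sequentially_Suc[THEN iffD1])
qed

lemma hnum_le_ln: "N > 0 \<Longrightarrow> hnum N \<le> 1 + ln (real N)"
proof (cases N)
  case (Suc n)
  have "harm n \<le> 1 + ln (real (Suc n))"
  proof (cases n)
    case (Suc j)
    \<comment> \<open>The difference of \<open>harm\<close> and \<open>ln\<close> decreases from the
      value 1, which is the constant in the bound.\<close>
    have "harm (Suc j) - ln (real (Suc j)) \<le> harm (Suc 0) - ln (real (Suc 0))"
      using decseq_harm_diff_ln unfolding decseq_def by blast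
    moreover have "ln (real (Suc j)) \<le> ln (real (Suc (Suc j)))" by simp
    moreover have "harm (Suc 0) - ln (real (Suc 0)) = 1" by (simp add: harm_expand)
    ultimately show ?thesis unfolding Suc by linarith
  qed (simp add: harm_expand)
  then show ?thesis using Suc by (simp add: hnum_Suc)
qed auto

lemma hsum_nonneg: "lo \<ge> 0 \<Longrightarrow> (hsum k lo hi :: real) \<ge> 0"
  by (induction k arbitrary: lo) (auto intro!: sum_nonneg mult_nonneg_nonneg)

text \<open>Every exponent is lowered to 1 and the ordering of the variables is dropped, leaving a
  power of a single sum.\<close>

lemma hsum_le_hnum_power:
  assumes "is_index k" "lo \<ge> 0"
  shows "hsum k lo (int N) \<le> hnum N ^ length k"
  using assms
proof (induction k arbitrary: lo)
  case (Cons a k)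
  have "hsum (a # k) lo (int N) \<le> (\<Sum>n\<in>{lo<..<int N}. inverse (of_int n) * hnum N ^ length k)"
    unfolding hsum.simps
  proof (intro sum_mono mult_mono)
    fix n assume n: "n \<in> {lo<..<int N}"
    have "real_of_int n ^ 1 \<le> of_int n ^ a"
      using n Cons.prems by (intro power_increasing) auto
    then show "inverse (real_of_int n ^ a) \<le> inverse (of_int n)"
      using n Cons.prems by (intro le_imp_inverse_le) auto
  qed (use Cons hsum_nonneg in auto)
  also have "\<dots> \<le> (\<Sum>n\<in>{0<..<int N}. inverse (of_int n) * hnum N ^ length k)"
    using Cons.prems hnum_nonneg by (intro sum_mono2) auto
  also have "\<dots> = hnum N ^ length (a # k)"
    by (simp add: hnum_def flip: sum_distrib_right)
  finally show ?case .
qed auto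

text \<open>Sequences negligible against every power of the harmonic numbers; unlike \<open>o(1)\<close> this is
  stable under multiplication by polynomials in \<open>hnum\<close>.\<close>

definition negl :: "(nat \<Rightarrow> real) \<Rightarrow> bool" where
  "negl f \<longleftrightarrow> (\<forall>c. (\<lambda>N. f N * hnum N ^ c) \<longlonglongrightarrow> 0)"

lemma negl_tendsto: "negl f \<Longrightarrow> f \<longlonglongrightarrow> 0"
  unfolding negl_def by (drule spec[of _ 0]) simp

lemma negl_0 [simp]: "negl (\<lambda>_. 0)"
  by (simp add: negl_def)

lemma negl_add: "negl f \<Longrightarrow> negl g \<Longrightarrow> negl (\<lambda>N. f N + g N)"
  unfolding negl_def distrib_right by (auto intro: tendsto_add_zero)

lemma negl_cmult: "negl f \<Longrightarrow> negl (\<lambda>N. c * f N)"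
  unfolding negl_def mult.assoc by (auto intro: tendsto_mult_right_zero)

lemma negl_mult_hnum: "negl f \<Longrightarrow> negl (\<lambda>N. hnum N * f N)"
  unfolding negl_def
proof
  fix c assume "\<forall>c. (\<lambda>N. f N * hnum N ^ c) \<longlonglongrightarrow> 0"
  then have "(\<lambda>N. f N * hnum N ^ Suc c) \<longlonglongrightarrow> 0" by blast
  then show "(\<lambda>N. hnum N * f N * hnum N ^ c) \<longlonglongrightarrow> 0" by (simp add: mult_ac)
qed

lemma negl_mult_poly: "negl f \<Longrightarrow> negl (\<lambda>N. poly p (hnum N) * f N)"
proof (induction p)
  case (pCons a p)
  then have "negl (\<lambda>N. a * f N + hnum N * (poly p (hnum N) * f N))"
    by (intro negl_add negl_cmult negl_mult_hnum) auto
  then show ?case by (simp add: algebra_simps)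
qed auto

text \<open>\<open>hnum\<close> is unbounded, so a nonzero polynomial in it stays away from 0. This
  is what makes an asymptotic expansion unique.\<close>

lemma negl_poly_imp_0:
  assumes "negl (\<lambda>N. poly p (hnum N))"
  shows "p = 0"
proof (rule ccontr)
  assume "p \<noteq> 0"
  have lim: "(\<lambda>N. poly p (hnum N)) \<longlonglongrightarrow> 0" using assms by (rule negl_tendsto)
  have big: "\<not> (\<lambda>N. poly q (hnum N)) \<longlonglongrightarrow> 0" if q: "lead_coeff q > 0" for q
  proof
    assume "(\<lambda>N. poly q (hnum N)) \<longlonglongrightarrow> 0"
    then have "eventually (\<lambda>N. poly q (hnum N) < lead_coeff q) sequentially"
      using q by (rule order_tendstoD)
    moreover obtain n where n: "\<forall>x\<ge>n. poly q x \<ge> lead_coeff q"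
      using poly_pinfty_gt_lc[OF q] by blast
    have "eventually (\<lambda>N. hnum N \<ge> n) sequentially"
      using hnum_at_top by (simp add: filterlim_at_top)
    ultimately have "eventually (\<lambda>N. False) sequentially"
      by eventually_elim (use n in force)
    then show False by simp
  qed
  have "(\<lambda>N. poly (- p) (hnum N)) \<longlonglongrightarrow> 0" using tendsto_minus[OF lim] by simp
  with lim big[of p] big[of "- p"] have "lead_coeff p = 0"
    by (metis lead_coeff_minus linorder_neqE_linordered_idom neg_0_less_iff_less)
  with \<open>p \<noteq> 0\<close> show False by simp
qed

text \<open>Half a power of \<open>n\<close> absorbs any power of the logarithm, and the exponent
  \<open>-3/2\<close> that is left still gives a convergent series.\<close>

lemma eventually_ln_power_div_le:
  "eventually (\<lambda>n. inverse (real n ^ 2) * (1 + ln (real n)) ^ e \<le> real n powr (-3/2)) sequentially"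
proof -
  have "((\<lambda>x::real. (1 + ln x) powr (1 + real e) / x powr (1/2)) \<longlongrightarrow> 0) at_top" by real_asymp
  then have "((\<lambda>n. (1 + ln (real n)) powr (1 + real e) / real n powr (1/2)) \<longlongrightarrow> 0) sequentially"
    by (rule filterlim_compose[OF _ filterlim_real_sequentially])
  then have "eventually (\<lambda>n. (1 + ln (real n)) powr (1 + real e) / real n powr (1/2) < 1) sequentially"
    by (rule order_tendstoD) simp
  then show ?thesis using eventually_gt_at_top[of 0]
  proof eventually_elim
    case (elim n)
    have ln: "ln (real n) \<ge> 0" using elim by simp
    \<comment> \<open>Raising the exponent is harmless because the base is at least 1, and it makes
      the exponent positive for every \<open>e\<close>.\<close>
    have "(1 + ln (real n)) ^ e \<le> (1 + ln (real n)) ^ (Suc e)"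
      using ln by (intro power_increasing) auto
    also have "\<dots> = (1 + ln (real n)) powr (1 + real e)"
      using ln powr_realpow[of "1 + ln (real n)" "Suc e"] by (simp del: power_Suc)
    also have "\<dots> \<le> real n powr (1/2)" using elim by (simp add: field_simps)
    finally have "inverse (real n ^ 2) * (1 + ln (real n)) ^ e \<le> inverse (real n ^ 2) * real n powr (1/2)"
      by (intro mult_left_mono) auto
    also have "\<dots> = real n powr (-2) * real n powr (1/2)"
      using elim by (simp add: powr_minus powr_numeral)
    also have "\<dots> = real n powr (-3/2)" by (simp flip: powr_add)
    finally show ?case .
  qed
qed

text \<open>By monotonicity, \<open>hnum N ^ c\<close> can be moved inside the tail of the series
  beyond \<open>N\<close> as \<open>hnum n ^ c\<close>; the enlarged series still converges, so its
  tails tend to 0.\<close>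

lemma negl_hsum_mzv:
  assumes "admissible k"
  shows "negl (\<lambda>N. hsum k 0 (int N) - mzv k)"
proof (cases k rule: rev_cases)
  case Nil
  then show ?thesis by (simp add: mzv_def)
next
  case (snoc k' x)
  with assms have k': "is_index k'" and x: "x \<ge> 2" by (auto simp: admissible_def)
  define d where "d = length k'"
  define a where "a = (\<lambda>n. inverse (real n ^ x) * hsum k' 0 (int n))"
  have a_nonneg: "a n \<ge> 0" for n
    unfolding a_def by (intro mult_nonneg_nonneg hsum_nonneg) auto
  have a_le: "a n \<le> inverse (real n ^ 2) * hnum n ^ d" if "n > 0" for n
    unfolding a_def d_def
  proof (intro mult_mono hsum_le_hnum_power k' hsum_nonneg)
    have "real n ^ 2 \<le> real n ^ x" using that x by (intro power_increasing) auto
    then show "inverse (real n ^ x) \<le> inverse (real n ^ 2)"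
      using that by (intro le_imp_inverse_le) auto
  qed auto
  have eq: "hsum k 0 (int N) = (\<Sum>n<N. a n)" for N
  proof -
    have "hsum k 0 (int N) = (\<Sum>n\<in>{1..<N}. a n)"
      unfolding snoc hsum_snoc sum_int_nat a_def by simp
    \<comment> \<open>The added term at \<open>n = 0\<close> vanishes, since \<open>x\<close> is
      positive and \<open>inverse 0 = 0\<close>.\<close>
    also have "\<dots> = (\<Sum>n<N. a n)"
      using x by (intro sum.mono_neutral_left) (auto simp: a_def)
    finally show ?thesis .
  qed
  have summable: "summable (\<lambda>n. a n * hnum n ^ c)" for c
  proof (rule summable_comparison_test_ev)
    show "summable (\<lambda>n. real n powr (-3/2))" by (simp add: summable_real_powr_iff)
    have "eventually (\<lambda>n. inverse (real n ^ 2) * (1 + ln (real n)) ^ (d + c) \<le> real n powr (-3/2)) sequentially"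
      by (rule eventually_ln_power_div_le)
    then show "eventually (\<lambda>n. norm (a n * hnum n ^ c) \<le> real n powr (-3/2)) sequentially"
      using eventually_gt_at_top[of 0]
    proof eventually_elim
      case (elim n)
      have "norm (a n * hnum n ^ c) = a n * hnum n ^ c"
        using a_nonneg hnum_nonneg by simp
      also have "\<dots> \<le> (inverse (real n ^ 2) * hnum n ^ d) * hnum n ^ c"
        using elim hnum_nonneg by (intro mult_right_mono a_le) auto
      also have "\<dots> = inverse (real n ^ 2) * hnum n ^ (d + c)" by (simp add: power_add)
      also have "\<dots> \<le> inverse (real n ^ 2) * (1 + ln (real n)) ^ (d + c)"
        using elim hnum_nonneg by (intro mult_left_mono power_mono hnum_le_ln) auto
      also note elim(1)
      finally show ?case .
    qed
  qed
  have "summable a" using summable[of 0] by simp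
  then have "mzv k = suminf a"
    unfolding mzv_def eq by (intro limI summable_LIMSEQ)
  show ?thesis unfolding negl_def
  proof
    fix c
    define b where "b = (\<lambda>n. a n * hnum n ^ c)"
    have "(\<lambda>N. suminf b - (\<Sum>n<N. b n)) \<longlonglongrightarrow> suminf b - suminf b"
      using summable[of c] unfolding b_def by (intro tendsto_diff tendsto_const summable_LIMSEQ)
    then have lim: "(\<lambda>N. suminf b - (\<Sum>n<N. b n)) \<longlonglongrightarrow> 0" by simp
    have bound: "norm ((hsum k 0 (int N) - mzv k) * hnum N ^ c) \<le> suminf b - (\<Sum>n<N. b n)" for N
    proof -
      have tail: "mzv k - hsum k 0 (int N) = (\<Sum>n. a (n + N))"
        unfolding eq \<open>mzv k = _\<close> using \<open>summable a\<close> by (simp add: suminf_minus_initial_segment)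
      have sa: "summable (\<lambda>n. a (n + N))" using \<open>summable a\<close> by (rule summable_ignore_initial_segment)
      have sb: "summable (\<lambda>n. b (n + N))"
        using summable[of c] unfolding b_def by (rule summable_ignore_initial_segment)
      have "(\<Sum>n. a (n + N)) \<ge> 0" using sa a_nonneg by (intro suminf_nonneg)
      then have "norm ((hsum k 0 (int N) - mzv k) * hnum N ^ c) = (\<Sum>n. a (n + N)) * hnum N ^ c"
        unfolding tail[symmetric] using hnum_nonneg[of N] by (simp add: abs_mult)
      also have "\<dots> = (\<Sum>n. a (n + N) * hnum N ^ c)" using sa by (rule suminf_mult2)
      also have "\<dots> \<le> (\<Sum>n. b (n + N))"
        using sa sb unfolding b_def
        by (intro suminf_le mult_left_mono power_mono summable_mult2)
          (simp_all add: hnum_mono hnum_nonneg a_nonneg)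
      also have "\<dots> = suminf b - (\<Sum>n<N. b n)"
        using summable[of c] unfolding b_def by (rule suminf_minus_initial_segment)
      finally show ?thesis .
    qed
    show "(\<lambda>N. (hsum k 0 (int N) - mzv k) * hnum N ^ c) \<longlonglongrightarrow> 0"
      by (rule Lim_null_comparison[OF always_eventually lim]) (use bound in blast)
  qed
qed

section \<open>Asymptotic expansions in harmonic numbers with coefficients in
  \<open>mzvZ\<close>\<close>

lemma mzvZ_of_int [simp]: "of_int n \<in> mzvZ" using mzvZ.rat[of "of_int n"] by simp
lemma mzvZ_of_nat [simp]: "of_nat n \<in> mzvZ" using mzvZ.rat[of "of_nat n"] by simp
lemma mzvZ_0 [simp]: "0 \<in> mzvZ" using mzvZ.rat[of 0] by simp
lemma mzvZ_1 [simp]: "1 \<in> mzvZ" using mzvZ.rat[of 1] by simp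

lemma mzvZ_uminus: "x \<in> mzvZ \<Longrightarrow> - x \<in> mzvZ"
  using mzvZ.mult[OF mzvZ.rat[of "-1"], of x] by simp

lemma mzvZ_diff: "x \<in> mzvZ \<Longrightarrow> y \<in> mzvZ \<Longrightarrow> x - y \<in> mzvZ"
  using mzvZ.add[of x "- y"] mzvZ_uminus[of y] by simp

lemma mzvZ_sum: "(\<And>i. i \<in> A \<Longrightarrow> f i \<in> mzvZ) \<Longrightarrow> sum f A \<in> mzvZ"
  by (induction A rule: infinite_finite_induct) (auto intro: mzvZ.add)

lemma mzvZ_power: "x \<in> mzvZ \<Longrightarrow> x ^ n \<in> mzvZ"
  by (induction n) (auto intro: mzvZ.mult)

text \<open>The variable of \<open>p\<close> plays the role of \<open>T\<close>. Membership of the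
  coefficients is carried along, so the existence proof yields it at the same time.\<close>

definition asymp_poly :: "(nat \<Rightarrow> real) \<Rightarrow> real poly \<Rightarrow> bool" where
  "asymp_poly f p \<longleftrightarrow> (\<forall>i. coeff p i \<in> mzvZ) \<and> negl (\<lambda>N. f N - poly p (hnum N))"

lemma asymp_poly_const: "c \<in> mzvZ \<Longrightarrow> negl (\<lambda>N. f N - c) \<Longrightarrow> asymp_poly f [:c:]"
  by (auto simp: asymp_poly_def coeff_pCons split: nat.split)

lemma asymp_poly_hnum: "asymp_poly hnum [:0, 1:]"
  by (auto simp: asymp_poly_def coeff_pCons split: nat.split)

lemma asymp_poly_add:
  assumes "asymp_poly f p" "asymp_poly g q"
  shows "asymp_poly (\<lambda>N. f N + g N) (p + q)"
  using assms negl_add[of "\<lambda>N. f N - poly p (hnum N)" "\<lambda>N. g N - poly q (hnum N)"]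
  by (auto simp: asymp_poly_def algebra_simps intro: mzvZ.add)

lemma asymp_poly_cmult:
  assumes "asymp_poly f p" "c \<in> mzvZ"
  shows "asymp_poly (\<lambda>N. c * f N) (smult c p)"
  using assms negl_cmult[of "\<lambda>N. f N - poly p (hnum N)" c]
  by (auto simp: asymp_poly_def algebra_simps intro: mzvZ.mult)

lemma asymp_poly_diff:
  assumes "asymp_poly f p" "asymp_poly g q"
  shows "asymp_poly (\<lambda>N. f N - g N) (p - q)"
  using asymp_poly_add[OF assms(1) asymp_poly_cmult[OF assms(2), of "-1"]] mzvZ_of_int[of "-1"] by simp

lemma negl_mult:
  assumes "negl f" "negl g"
  shows "negl (\<lambda>N. f N * g N)"
  unfolding negl_def
proof
  fix c
  have "(\<lambda>N. f N * (g N * hnum N ^ c)) \<longlonglongrightarrow> 0"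
    by (rule tendsto_mult_zero[OF negl_tendsto[OF assms(1)]]) (use assms(2) in \<open>simp add: negl_def\<close>)
  then show "(\<lambda>N. f N * g N * hnum N ^ c) \<longlonglongrightarrow> 0" by (simp add: mult.assoc)
qed

lemma asymp_poly_mult:
  assumes "asymp_poly f p" "asymp_poly g q"
  shows "asymp_poly (\<lambda>N. f N * g N) (p * q)"
  unfolding asymp_poly_def
proof
  show "\<forall>i. coeff (p * q) i \<in> mzvZ"
    using assms by (auto simp: asymp_poly_def coeff_mult intro!: mzvZ_sum mzvZ.mult)
  define e where "e = (\<lambda>N. f N - poly p (hnum N))"
  define d where "d = (\<lambda>N. g N - poly q (hnum N))"
  have "negl e" "negl d" using assms by (simp_all add: asymp_poly_def e_def d_def)
  then have "negl (\<lambda>N. e N * d N + (poly p (hnum N) * d N + poly q (hnum N) * e N))"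
    by (intro negl_add negl_mult negl_mult_poly)
  then show "negl (\<lambda>N. f N * g N - poly (p * q) (hnum N))"
    by (simp add: e_def d_def algebra_simps)
qed

lemma asymp_poly_sum_mset:
  assumes "\<And>m. m \<in># R \<Longrightarrow> asymp_poly (F m) (P m)"
  shows "asymp_poly (\<lambda>N. \<Sum>m\<in>#R. F m N) (\<Sum>m\<in>#R. P m)"
  using assms
proof (induction R)
  case empty
  then show ?case by (simp add: asymp_poly_def)
qed (simp add: asymp_poly_add)

lemma asymp_poly_unique:
  assumes "asymp_poly f p" "asymp_poly f q"
  shows "p = q"
proof -
  \<comment> \<open>The factor \<open>-1\<close> cancels the minus sign in front of the polynomial
    in \<open>asymp_poly\<close>; the sequence itself is zero.\<close>
  have "asymp_poly (\<lambda>N. - 1 * (f N - f N)) (smult (- 1) (p - q))"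
    using asymp_poly_diff[OF assms] mzvZ_of_int[of "-1"] by (intro asymp_poly_cmult) auto
  then have "negl (\<lambda>N. poly (p - q) (hnum N))" unfolding asymp_poly_def by simp
  then have "p - q = 0" by (rule negl_poly_imp_0)
  then show ?thesis by simp
qed

section \<open>Trailing ones and the unique harmonic regularisation\<close>

lemma stuffle_Nil_right [simp]: "stuffle k [] = [k]"
  by (cases k) auto

text \<open>Requiring \<open>j\<close> to be nonempty makes the notion stable under prepending an
  entry: with \<open>j\<close> empty, a prepended 1 would be one more trailing one.\<close>

definition trailing_ones_le :: "nat \<Rightarrow> nat list \<Rightarrow> bool" where
  "trailing_ones_le n m \<longleftrightarrow> (\<exists>j i. m = j @ replicate i 1 \<and> admissible j \<and> j \<noteq> [] \<and> i \<le> n)"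

lemma trailing_ones_leI:
  "admissible j \<Longrightarrow> j \<noteq> [] \<Longrightarrow> i \<le> n \<Longrightarrow> trailing_ones_le n (j @ replicate i 1)"
  unfolding trailing_ones_le_def by blast

lemma trailing_ones_le_Cons:
  assumes "trailing_ones_le n m" "a \<ge> 1" "n \<le> n'"
  shows "trailing_ones_le n' (a # m)"
proof -
  obtain j i where "m = j @ replicate i 1" "admissible j" "j \<noteq> []" "i \<le> n"
    using assms(1) unfolding trailing_ones_le_def by blast
  then show ?thesis using trailing_ones_leI[of "a # j" i n'] assms by (simp add: admissible_def)
qed

text \<open>Multiplying by \<open>[1]\<close> expresses an index with \<open>n + 1\<close> trailing ones through indices with at
  most \<open>n\<close> of them; this drives both existence and uniqueness of the regularisation.\<close>

lemma stuffle_trailing_ones: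
  assumes "admissible j"
  shows "\<exists>R. mset (stuffle (j @ replicate n 1) [1]) = replicate_mset (Suc n) (j @ replicate (Suc n) 1) + R
    \<and> (\<forall>m\<in>#R. trailing_ones_le n m)"
  using assms
proof (induction j)
  case Nil
  show ?case
  proof (induction n)
    case (Suc n)
    then obtain R where R: "mset (stuffle (replicate n 1) [1]) = replicate_mset (Suc n) (replicate (Suc n) 1) + R"
      "\<forall>m\<in>#R. trailing_ones_le n m" by (auto simp del: replicate_Suc replicate_mset_Suc)
    have "trailing_ones_le (Suc n) (2 # replicate n 1)"
      using trailing_ones_leI[of "[2]" n "Suc n"] by (simp add: admissible_def)
    \<comment> \<open>Inserting the new 1 in front gives one further copy of the all-ones index;
      merging it with the leading 1 gives the entry 2.\<close>
    then show ?case using R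
      by (intro exI[of _ "image_mset (Cons 1) R + {#2 # replicate n 1#}"])
        (auto simp: numeral_2_eq_2 intro: trailing_ones_le_Cons)
  qed auto
next
  case (Cons a j)
  then have a: "a \<ge> 1" and adm: "admissible j" by (auto simp: admissible_def split: if_splits)
  from Cons.IH[OF adm] obtain R where
    R: "mset (stuffle (j @ replicate n 1) [1]) = replicate_mset (Suc n) (j @ replicate (Suc n) 1) + R"
      "\<forall>m\<in>#R. trailing_ones_le n m" by blast
  have "trailing_ones_le n (1 # a # j @ replicate n 1)"
    using trailing_ones_leI[of "1 # a # j" n n] Cons.prems by (auto simp: admissible_def)
  moreover have "trailing_ones_le n (Suc a # j @ replicate n 1)"
    using trailing_ones_leI[of "Suc a # j" n n] Cons.prems by (auto simp: admissible_def split: if_splits)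
  \<comment> \<open>Either the new 1 goes behind \<open>a\<close>, where the induction hypothesis
    applies, or it stands in front of \<open>a\<close> or merges with it; the last two cases create
    no trailing one.\<close>
  ultimately show ?case using R a
    by (intro exI[of _ "image_mset (Cons a) R + {#1 # a # j @ replicate n 1, Suc a # j @ replicate n 1#}"])
      (auto intro: trailing_ones_le_Cons)
qed

lemma index_trailing_ones:
  assumes "is_index k"
  obtains j n where "k = j @ replicate n 1" "admissible j"
  using assms
proof (induction k arbitrary: thesis rule: rev_induct)
  case Nil
  then show ?case by (metis admissible_def append_Nil replicate_0 is_index_simps(1))
next
  case (snoc x k)
  show ?case
  proof (cases "x = 1")
    case True
    obtain j n where "k = j @ replicate n 1" "admissible j" using snoc.IH snoc.prems(2) by auto
    then show ?thesis using True snoc.prems(1)[of j "Suc n"] by (simp flip: replicate_append_same)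
  next
    case False
    then show ?thesis using snoc.prems(1)[of "k @ [x]" 0] snoc.prems(2) by (auto simp: admissible_def)
  qed
qed

lemma admissible_index: "admissible j \<Longrightarrow> is_index (j @ replicate n 1)"
  by (auto simp: admissible_def is_index_def)

text \<open>Induction on the number of trailing ones, with admissible indices as base: the product
  with \<open>hnum\<close> is solved for the index with one more trailing one.\<close>

lemma ex_asymp_poly_hsum:
  assumes "is_index k"
  shows "\<exists>p. asymp_poly (\<lambda>N. hsum k 0 (int N)) p"
proof -
  have "\<exists>p. asymp_poly (\<lambda>N. hsum (j @ replicate n 1) 0 (int N)) p" if "admissible j" for j n
    using that
  proof (induction n arbitrary: j rule: less_induct)
    case (less n)
    show ?case
    proof (cases n)
      case 0
      then show ?thesis
        using asymp_poly_const[OF mzvZ.mzv negl_hsum_mzv] less.prems by auto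
    next
      case (Suc n')
      let ?k = "j @ replicate n' 1"
      from stuffle_trailing_ones[OF less.prems] obtain R where
        R: "mset (stuffle ?k [1]) = replicate_mset (Suc n') (j @ replicate (Suc n') 1) + R"
        "\<forall>m\<in>#R. trailing_ones_le n' m" by blast
      obtain p where p: "asymp_poly (\<lambda>N. hsum ?k 0 (int N)) p"
        using less.IH[of n' j] less.prems Suc by auto
      have "\<forall>m\<in>#R. \<exists>p. asymp_poly (\<lambda>N. hsum m 0 (int N)) p"
        using R(2) less.IH Suc by (metis trailing_ones_le_def le_imp_less_Suc)
      then obtain P where P: "\<And>m. m \<in># R \<Longrightarrow> asymp_poly (\<lambda>N. hsum m 0 (int N)) (P m)" by metis
      have prod: "hsum ?k 0 (int N) * hnum N =
          of_nat (Suc n') * hsum (j @ replicate n 1) 0 (int N) + (\<Sum>m\<in>#R. hsum m 0 (int N))" for N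
      proof -
        have "hsum ?k 0 (int N) * hnum N = (\<Sum>m\<in>#mset (stuffle ?k [1]). hsum m 0 (int N))"
          unfolding hnum_def hsum_mult by (simp flip: sum_mset_sum_list)
        then show ?thesis unfolding R(1) Suc by (simp add: ring_distribs)
      qed
      \<comment> \<open>Solving divides by the multiplicity \<open>Suc n'\<close>, which is allowed
        because \<open>mzvZ\<close> contains the rationals.\<close>
      have "of_rat (inverse (of_nat (Suc n'))) \<in> mzvZ" by (rule mzvZ.rat)
      then have "asymp_poly (\<lambda>N. inverse (real (Suc n')) * (hsum ?k 0 (int N) * hnum N - (\<Sum>m\<in>#R. hsum m 0 (int N))))
          (smult (inverse (real (Suc n'))) (p * [:0, 1:] - (\<Sum>m\<in>#R. P m)))"
        by (intro asymp_poly_cmult asymp_poly_diff asymp_poly_mult p asymp_poly_hnum asymp_poly_sum_mset P)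
          (auto simp: of_rat_inverse of_rat_add)
      then show ?thesis unfolding prod by (auto simp: field_simps simp del: of_nat_Suc)
    qed
  qed
  moreover obtain j n where "k = j @ replicate n 1" "admissible j"
    using assms by (rule index_trailing_ones)
  ultimately show ?thesis by blast
qed

text \<open>The predicate under \<open>THE\<close> in \<open>zeta_reg\<close>, named so that
  existence and uniqueness can be stated for it.\<close>

definition is_zeta_reg :: "(nat list \<Rightarrow> real poly) \<Rightarrow> bool" where
  "is_zeta_reg Z \<longleftrightarrow> Z [] = 1
      \<and> (\<forall>k l. is_index k \<longrightarrow> is_index l \<longrightarrow> Z k * Z l = (\<Sum>m\<leftarrow>stuffle k l. Z m))
      \<and> (\<forall>k. admissible k \<longrightarrow> Z k = [:mzv k:])
      \<and> Z [1] = [:0, 1:]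
      \<and> (\<forall>k. \<not> is_index k \<longrightarrow> Z k = 0)"

lemma is_zeta_regD:
  assumes "is_zeta_reg Z"
  shows "is_index k \<Longrightarrow> is_index l \<Longrightarrow> Z k * Z l = (\<Sum>m\<leftarrow>stuffle k l. Z m)"
    "admissible k \<Longrightarrow> Z k = [:mzv k:]" "Z [1] = [:0, 1:]" "\<not> is_index k \<Longrightarrow> Z k = 0"
proof -
  have 1: "\<forall>k l. is_index k \<longrightarrow> is_index l \<longrightarrow> Z k * Z l = (\<Sum>m\<leftarrow>stuffle k l. Z m)"
    using assms unfolding is_zeta_reg_def by (elim conjE)
  have 2: "\<forall>k. admissible k \<longrightarrow> Z k = [:mzv k:]"
    using assms unfolding is_zeta_reg_def by (elim conjE)
  have 3: "\<forall>k. \<not> is_index k \<longrightarrow> Z k = 0"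
    using assms unfolding is_zeta_reg_def by (elim conjE)
  show "Z [1] = [:0, 1:]"
    using assms unfolding is_zeta_reg_def by (elim conjE)
  show "is_index k \<Longrightarrow> is_index l \<Longrightarrow> Z k * Z l = (\<Sum>m\<leftarrow>stuffle k l. Z m)"
    using 1 by blast
  show "admissible k \<Longrightarrow> Z k = [:mzv k:]" using 2 by blast
  show "\<not> is_index k \<Longrightarrow> Z k = 0" using 3 by blast
qed

text \<open>The product with \<open>[1]\<close> determines \<open>Suc n'\<close> times the next
  value from values with fewer trailing ones, and this factor cancels in \<open>real poly\<close>.
  Non-indices are fixed by the default 0.\<close>

lemma is_zeta_reg_unique:
  assumes "is_zeta_reg Z" "is_zeta_reg Z'"
  shows "Z = Z'"
proof
  have eq: "Z (j @ replicate n 1) = Z' (j @ replicate n 1)" if "admissible j" for j n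
    using that
  proof (induction n arbitrary: j rule: less_induct)
    case (less n)
    show ?case
    proof (cases n)
      case 0
      then show ?thesis
        using is_zeta_regD(2)[OF assms(1) less.prems] is_zeta_regD(2)[OF assms(2) less.prems] by simp
    next
      case (Suc n')
      let ?k = "j @ replicate n' 1"
      from stuffle_trailing_ones[OF less.prems] obtain R where
        R: "mset (stuffle ?k [1]) = replicate_mset (Suc n') (j @ replicate (Suc n') 1) + R"
        "\<forall>m\<in>#R. trailing_ones_le n' m" by blast
      have prod: "W ?k * [:0, 1:] = of_nat (Suc n') * W (j @ replicate n 1) + (\<Sum>m\<in>#R. W m)"
        if "is_zeta_reg W" for W
      proof -
        have "W ?k * [:0, 1:] = W ?k * W [1]" unfolding is_zeta_regD(3)[OF that] ..
        also have "\<dots> = (\<Sum>m\<leftarrow>stuffle ?k [1]. W m)"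
          by (rule is_zeta_regD(1)[OF that admissible_index[OF less.prems]]) simp
        also have "\<dots> = (\<Sum>m\<in>#mset (stuffle ?k [1]). W m)" by (simp flip: sum_mset_sum_list)
        finally have "W ?k * [:0, 1:] = (\<Sum>m\<in>#mset (stuffle ?k [1]). W m)" .
        then show ?thesis unfolding R(1) Suc image_mset_union image_replicate_mset
          sum_mset.union sum_mset_replicate_mset .
      qed
      have "Z m = Z' m" if "m \<in># R" for m
      proof -
        obtain j' i where "m = j' @ replicate i 1" "admissible j'" "i \<le> n'"
          using bspec[OF R(2) \<open>m \<in># R\<close>] by (auto simp: trailing_ones_le_def)
        then show ?thesis using less.IH[of i j'] Suc by simp
      qed
      then have RZ: "image_mset Z R = image_mset Z' R" by (rule image_mset_cong)
      have kZ: "Z ?k = Z' ?k" using less.IH[of n' j] less.prems Suc by simp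
      have "of_nat (Suc n') * Z (j @ replicate n 1) = Z ?k * [:0, 1:] - (\<Sum>m\<in>#R. Z m)"
        unfolding prod[OF assms(1)] by (rule add_diff_cancel_right'[symmetric])
      also have "\<dots> = of_nat (Suc n') * Z' (j @ replicate n 1)"
        unfolding kZ RZ prod[OF assms(2)] by (rule add_diff_cancel_right')
      finally have "of_nat (Suc n') * Z (j @ replicate n 1) = of_nat (Suc n') * Z' (j @ replicate n 1)" .
      then show ?thesis unfolding mult_cancel_left of_nat_eq_0_iff by (elim disjE) simp_all
    qed
  qed
  fix k
  show "Z k = Z' k"
  proof (cases "is_index k")
    case True
    then obtain j n where "k = j @ replicate n 1" "admissible j" by (rule index_trailing_ones)
    then show ?thesis using eq by simp
  next
    case False
    then show ?thesis using is_zeta_regD(4)[OF assms(1)] is_zeta_regD(4)[OF assms(2)] by simp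
  qed
qed

lemma stuffle_index:
  assumes "is_index k" "is_index l" "m \<in> set (stuffle k l)"
  shows "is_index m"
  using assms
proof (induction k l arbitrary: m rule: stuffle.induct)
  case (3 a k b l)
  have k: "a \<ge> 1" "is_index k" and l: "b \<ge> 1" "is_index l" using "3.prems" by simp_all
  from "3.prems"(3) have "m \<in> Cons a ` set (stuffle k (b # l)) \<union> Cons b ` set (stuffle (a # k) l) \<union>
      Cons (a + b) ` set (stuffle k l)"
    by (simp only: stuffle.simps set_append set_map Un_assoc)
  then consider m' where "m = a # m'" "m' \<in> set (stuffle k (b # l))"
    | m' where "m = b # m'" "m' \<in> set (stuffle (a # k) l)"
    | m' where "m = (a + b) # m'" "m' \<in> set (stuffle k l)"
    by blast
  then show ?case
  proof cases
    case 1
    then show ?thesis using k "3.IH"(1)[OF k(2) "3.prems"(2)] by simp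
  next
    case 2
    then show ?thesis using l "3.IH"(2)[OF "3.prems"(1) l(2)] by simp
  next
    case 3
    then show ?thesis using k "3.IH"(3)[OF k(2) l(2)] by simp
  qed
qed simp_all

text \<open>The expansion polynomials of the truncated sums meet the specification, hence they are
  \<open>zeta_reg\<close>, and their coefficients were in \<open>mzvZ\<close> by
  construction.\<close>

lemma zeta_reg_mzvZ: "coeff (zeta_reg k) i \<in> mzvZ"
proof -
  define Z where "Z = (\<lambda>k. if is_index k then SOME p. asymp_poly (\<lambda>N. hsum k 0 (int N)) p else 0)"
  have Z: "asymp_poly (\<lambda>N. hsum k 0 (int N)) (Z k)" if "is_index k" for k
    unfolding Z_def using someI_ex[OF ex_asymp_poly_hsum[OF that]] that by (simp only: if_True)
  have adm: "Z k = [:mzv k:]" if "admissible k" for k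
  proof (rule asymp_poly_unique[OF Z])
    show "is_index k" using that by (simp add: admissible_def)
    show "asymp_poly (\<lambda>N. hsum k 0 (int N)) [:mzv k:]"
      by (intro asymp_poly_const mzvZ.mzv negl_hsum_mzv that)
  qed
  have "is_zeta_reg Z"
    unfolding is_zeta_reg_def
  proof (intro conjI allI impI)
    show "Z [] = 1" using adm[of "[]"] by (simp add: admissible_def mzv_def one_pCons)
    show "Z [1] = [:0, 1:]"
    proof (rule asymp_poly_unique[OF Z])
      show "asymp_poly (\<lambda>N. hsum [1] 0 (int N)) [:0, 1:]"
        unfolding hnum_def[symmetric] by (rule asymp_poly_hnum)
    qed simp
    fix k l assume kl: "is_index k" "is_index l"
    have "asymp_poly (\<lambda>N. \<Sum>m\<in>#mset (stuffle k l). hsum m 0 (int N)) (\<Sum>m\<in>#mset (stuffle k l). Z m)"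
      by (intro asymp_poly_sum_mset Z stuffle_index[OF kl]) simp
    then have "asymp_poly (\<lambda>N. \<Sum>m\<leftarrow>stuffle k l. hsum m 0 (int N)) (\<Sum>m\<leftarrow>stuffle k l. Z m)"
      by (simp flip: sum_mset_sum_list)
    \<comment> \<open>The product rule holds exactly for truncated sums; comparing two expansions of
      one sequence transfers it to the polynomials.\<close>
    moreover have "asymp_poly (\<lambda>N. \<Sum>m\<leftarrow>stuffle k l. hsum m 0 (int N)) (Z k * Z l)"
      unfolding hsum_mult[symmetric] using kl by (intro asymp_poly_mult Z)
    ultimately show "Z k * Z l = (\<Sum>m\<leftarrow>stuffle k l. Z m)"
      by (rule asymp_poly_unique[rotated])
  next
    fix k
    show "admissible k \<Longrightarrow> Z k = [:mzv k:]" by (rule adm)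
    show "\<not> is_index k \<Longrightarrow> Z k = 0" by (simp add: Z_def)
  qed
  then have "(THE Z. is_zeta_reg Z) = Z"
    using is_zeta_reg_unique[OF _ \<open>is_zeta_reg Z\<close>] by (intro the_equality)
  then have "zeta_reg = Z" unfolding zeta_reg_def is_zeta_reg_def .
  then show ?thesis
  proof (cases "is_index k")
    case True
    then show ?thesis using Z[OF True] unfolding \<open>zeta_reg = Z\<close> asymp_poly_def by blast
  next
    case False
    then show ?thesis unfolding \<open>zeta_reg = Z\<close> by (simp add: Z_def)
  qed
qed

section \<open>Expansion of translated harmonic sums modulo powers of a prime\<close>

text \<open>\<open>padic_cong\<close> looks at lowest terms only. Any fraction with denominator
  prime to \<open>p\<close> may be used instead, since cancelling common factors affects neither
  divisibility condition.\<close>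

lemma padic_cong_iff:
  assumes "prime p"
  shows "padic_cong n p q \<longleftrightarrow> (\<exists>a b. q = of_int a / of_int b \<and> int p ^ n dvd a \<and> \<not> int p dvd b)"
proof
  assume "padic_cong n p q"
  then show "\<exists>a b. q = of_int a / of_int b \<and> int p ^ n dvd a \<and> \<not> int p dvd b"
    unfolding padic_cong_def by (auto split: prod.splits dest: quotient_of_div)
next
  assume "\<exists>a b. q = of_int a / of_int b \<and> int p ^ n dvd a \<and> \<not> int p dvd b"
  then obtain a b where ab: "q = of_int a / of_int b" "int p ^ n dvd a" "\<not> int p dvd b" by blast
  obtain c d where cd: "quotient_of q = (c, d)" by force
  have d: "d > 0" "coprime c d" using cd quotient_of_denom_pos quotient_of_coprime by auto
  have b: "b \<noteq> 0" using ab(3) by auto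
  have "q = of_int c / of_int d" using cd by (rule quotient_of_div)
  then have "(of_int (a * d) :: rat) = of_int (c * b)"
    using ab(1) b d by (simp add: field_simps)
  then have eq: "a * d = c * b" by (simp only: of_int_eq_iff)
  have "int p ^ n dvd c * b" unfolding eq[symmetric] using ab(2) by simp
  moreover have "coprime (int p ^ n) b"
    using assms ab(3) by (simp add: prime_imp_coprime)
  ultimately have "int p ^ n dvd c" by (simp add: coprime_dvd_mult_left_iff)
  moreover have "\<not> int p dvd d"
  proof
    have "d dvd c * b" using eq by (metis dvd_triv_right)
    then have "d dvd b" using d(2) by (simp add: coprime_dvd_mult_right_iff coprime_commute)
    moreover assume "int p dvd d"
    ultimately show False using ab(3) dvd_trans by blast
  qed
  ultimately show "padic_cong n p q" by (simp add: padic_cong_def cd)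
qed

context
  fixes p :: nat
  assumes p: "prime p"
begin

lemma padic_cong_of_int: "int p ^ n dvd a \<Longrightarrow> padic_cong n p (of_int a)"
  unfolding padic_cong_iff[OF p] using p
  by (intro exI[of _ a] exI[of _ 1]) (auto dest: not_prime_unit)

lemma padic_cong_0 [simp]: "padic_cong n p 0"
  using padic_cong_of_int[of n 0] by simp

lemma padic_cong_add:
  assumes "padic_cong n p x" "padic_cong n p y"
  shows "padic_cong n p (x + y)"
proof -
  obtain a b c d where "x = of_int a / of_int b" "int p ^ n dvd a" "\<not> int p dvd b"
    "y = of_int c / of_int d" "int p ^ n dvd c" "\<not> int p dvd d"
    using assms unfolding padic_cong_iff[OF p] by blast
  moreover from this have "b \<noteq> 0" "d \<noteq> 0" by auto
  ultimately have "x + y = of_int (a * d + c * b) / of_int (b * d)" "int p ^ n dvd a * d + c * b"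
    "\<not> int p dvd b * d"
    using p by (auto simp: add_frac_eq prime_dvd_mult_iff)
  then show ?thesis unfolding padic_cong_iff[OF p] by blast
qed

lemma padic_cong_mult:
  assumes "padic_cong m p x" "padic_cong n p y"
  shows "padic_cong (m + n) p (x * y)"
proof -
  obtain a b c d where "x = of_int a / of_int b" "int p ^ m dvd a" "\<not> int p dvd b"
    "y = of_int c / of_int d" "int p ^ n dvd c" "\<not> int p dvd d"
    using assms unfolding padic_cong_iff[OF p] by blast
  then have "x * y = of_int (a * c) / of_int (b * d)" "int p ^ (m + n) dvd a * c"
    "\<not> int p dvd b * d"
    using p by (auto simp: prime_dvd_mult_iff power_add mult_dvd_mono)
  then show ?thesis unfolding padic_cong_iff[OF p] by blast
qed

lemma padic_cong_mono: "padic_cong m p x \<Longrightarrow> n \<le> m \<Longrightarrow> padic_cong n p x"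
  unfolding padic_cong_iff[OF p] using dvd_trans[OF le_imp_power_dvd[of n m "int p"]] by blast

lemma padic_cong_mult_left: "padic_cong 0 p x \<Longrightarrow> padic_cong n p y \<Longrightarrow> padic_cong n p (x * y)"
  using padic_cong_mult[of 0 x n y] by simp

lemma padic_cong_mult_right: "padic_cong n p x \<Longrightarrow> padic_cong 0 p y \<Longrightarrow> padic_cong n p (x * y)"
  using padic_cong_mult[of n x 0 y] by simp

lemma padic_cong_uminus: "padic_cong n p x \<Longrightarrow> padic_cong n p (- x)"
  using padic_cong_mult_left[of "-1" n x] padic_cong_of_int[of 0 "-1"] by simp

lemma padic_cong_diff: "padic_cong n p x \<Longrightarrow> padic_cong n p y \<Longrightarrow> padic_cong n p (x - y)"
  using padic_cong_add[of n x "- y"] padic_cong_uminus[of n y] by simp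

lemma padic_cong_sum: "(\<And>i. i \<in> A \<Longrightarrow> padic_cong n p (f i)) \<Longrightarrow> padic_cong n p (sum f A)"
  by (induction A rule: infinite_finite_induct) (auto intro: padic_cong_add)

lemma padic_int_power: "padic_cong 0 p x \<Longrightarrow> padic_cong 0 p (x ^ k)"
proof (induction k)
  case (Suc k)
  then show ?case using padic_cong_mult[of 0 x 0 "x ^ k"] by simp
qed (use padic_cong_of_int[of 0 1] in simp)

lemma padic_cong_power: "padic_cong 1 p x \<Longrightarrow> padic_cong k p (x ^ k)"
proof (induction k)
  case (Suc k)
  then show ?case using padic_cong_mult[of 1 x k "x ^ k"] by simp
qed (use padic_cong_of_int[of 0 1] in simp)

lemma padic_int_inverse: "\<not> int p dvd a \<Longrightarrow> padic_cong 0 p (inverse (of_int a))"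
  unfolding padic_cong_iff[OF p]
  by (intro exI[of _ 1] exI[of _ a]) (simp add: inverse_eq_divide)

lemma not_dvd_between: "m \<in> {0<..<int p} \<Longrightarrow> \<not> int p dvd m"
  using zdvd_imp_le by fastforce

lemma padic_int_hsum:
  assumes "0 \<le> lo" "hi \<le> int p"
  shows "padic_cong 0 p (hsum k lo hi)"
  using assms
proof (induction k arbitrary: lo)
  case Nil
  then show ?case using padic_cong_of_int[of 0 1] by simp
next
  case (Cons a k)
  then show ?case unfolding hsum.simps power_inverse[symmetric]
    by (intro padic_cong_sum padic_cong_mult_left padic_int_power padic_int_inverse not_dvd_between)
      auto
qed

lemma padic_int_shift_sum:
  assumes "\<And>l. padic_cong 0 p (F l)"
  shows "padic_cong 0 p (shift_sum k m F)"
  using assms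
proof (induction k arbitrary: m F)
  case (Cons k ks)
  have "padic_cong 0 p (of_nat n)" for n using padic_cong_of_int[of 0 "int n"] by simp
  with Cons show ?case by (auto intro!: padic_cong_sum padic_cong_mult_left)
qed auto

end

text \<open>Multiplying the truncated series of \<open>(1 - y)^(-k-1)\<close> by
  \<open>1 - y\<close> lowers the exponent: Pascal's rule telescopes, and only the top term survives
  as an error.\<close>

lemma truncated_negative_binomial:
  fixes y :: "'a::comm_ring_1"
  shows "(1 - y) * (\<Sum>w<Suc n. of_nat ((k + w) choose w) * y ^ w) =
    (\<Sum>w<Suc n. of_nat ((k + w - 1) choose w) * y ^ w) - of_nat ((k + n) choose n) * y ^ Suc n"
proof (induction n)
  case (Suc n)
  have "(k + Suc n) choose Suc n = ((k + n) choose n) + ((k + Suc n - 1) choose Suc n)"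
    by simp
  then have "of_nat ((k + Suc n) choose Suc n) =
      (of_nat ((k + n) choose n) + of_nat ((k + Suc n - 1) choose Suc n) :: 'a)"
    by (metis of_nat_add)
  with Suc show ?case
    unfolding sum.lessThan_Suc[of _ "Suc n"] distrib_left
    by (simp only: power_Suc) (simp add: algebra_simps)
qed simp

text \<open>Each step in \<open>k\<close> costs an integral multiple of \<open>y ^ n\<close>, which
  is divisible by \<open>p ^ n\<close>.\<close>

lemma padic_cong_negative_binomial:
  assumes p: "prime p" and y: "padic_cong 1 p y" and n: "n > 0"
  shows "padic_cong n p ((1 - y) ^ k * (\<Sum>w<n. of_nat ((k + w - 1) choose w) * y ^ w) - 1)"
proof (induction k)
  case 0
  have "(\<Sum>w<n. of_nat ((0 + w - 1) choose w) * y ^ w) = (\<Sum>w<n. if w = 0 then 1 else 0)"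
    by (intro sum.cong refl) (auto simp: binomial_eq_0)
  then show ?case using n padic_cong_0[OF p] by simp
next
  case (Suc k)
  obtain n' where n': "n = Suc n'" using n by (cases n) auto
  have "(1 - y) ^ Suc k * (\<Sum>w<n. of_nat ((Suc k + w - 1) choose w) * y ^ w) - 1 =
    (1 - y) ^ k * ((1 - y) * (\<Sum>w<n. of_nat ((k + w) choose w) * y ^ w)) - 1"
    by (simp add: mult_ac)
  also have "\<dots> = ((1 - y) ^ k * (\<Sum>w<n. of_nat ((k + w - 1) choose w) * y ^ w) - 1) -
      (1 - y) ^ k * of_nat ((k + n') choose n') * y ^ n"
    unfolding n' truncated_negative_binomial by (simp add: algebra_simps)
  also have "padic_cong n p \<dots>"
  proof (rule padic_cong_diff[OF p Suc.IH])
    have "padic_cong 0 p (1 - y)"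
      using padic_cong_of_int[OF p, of 0 1] padic_cong_mono[OF p y, of 0] by (intro padic_cong_diff[OF p]) auto
    then have "padic_cong 0 p ((1 - y) ^ k * of_nat ((k + n') choose n'))"
      using padic_cong_of_int[OF p, of 0 "int ((k + n') choose n')"]
      by (intro padic_cong_mult_left[OF p] padic_int_power[OF p]) auto
    then show "padic_cong n p ((1 - y) ^ k * of_nat ((k + n') choose n') * y ^ n)"
      by (rule padic_cong_mult_left[OF p _ padic_cong_power[OF p y]])
  qed
  finally show ?case .
qed

lemma padic_cong_inverse_power_shift:
  assumes p: "prime p" and m: "m \<in> {0<..<int p}" and c: "int p dvd c" and n: "n > 0"
  shows "padic_cong n p (inverse (of_int (c + m) ^ k) -
    (\<Sum>w<n. of_nat ((k + w - 1) choose w) * (- of_int c) ^ w * inverse (of_int m ^ (k + w))))"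
proof -
  \<comment> \<open>Chosen so that \<open>c + m = m (1 - y)\<close>, with \<open>y\<close> divisible
    by \<open>p\<close>.\<close>
  define y :: rat where "y = - of_int c * inverse (of_int m)"
  define S :: rat where "S = (\<Sum>w<n. of_nat ((k + w - 1) choose w) * y ^ w)"
  define u :: rat where "u = inverse (of_int (c + m))"
  have nm: "\<not> int p dvd m" using not_dvd_between[OF p m] .
  then have ncm: "\<not> int p dvd c + m" using c by (simp add: dvd_add_right_iff)
  have m0: "(of_int m :: rat) \<noteq> 0" using m by auto
  have "c + m \<noteq> 0" using ncm by auto
  then have cm0: "(of_int (c + m) :: rat) \<noteq> 0" by (simp only: of_int_eq_0_iff not_False_eq_True)
  have y: "padic_cong 1 p y"
    unfolding y_def using c padic_cong_of_int[OF p, of 1 "- c"]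
    by (intro padic_cong_mult_right[OF p] padic_int_inverse[OF p] nm) simp
  have S: "(\<Sum>w<n. of_nat ((k + w - 1) choose w) * (- of_int c) ^ w * inverse (of_int m ^ (k + w))) =
      inverse (of_int m ^ k) * S"
    unfolding S_def y_def sum_distrib_left power_mult_distrib power_add inverse_mult_distrib power_inverse
    by (intro sum.cong refl) (simp only: mult_ac)
  have "1 - y = of_int (c + m) * inverse (of_int m)" using m0 by (simp add: y_def field_simps)
  then have "u * (1 - y) = inverse (of_int m)"
    using cm0 by (simp add: u_def del: of_int_add)
  then have "u ^ k * (1 - y) ^ k = inverse (of_int m ^ k)"
    by (simp add: power_inverse flip: power_mult_distrib)
  then have "inverse (of_int (c + m) ^ k) - inverse (of_int m ^ k) * S = - (u ^ k * ((1 - y) ^ k * S - 1))"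
    by (simp add: u_def power_inverse algebra_simps del: of_int_add)
  also have "padic_cong n p \<dots>"
    unfolding S_def u_def
    by (intro padic_cong_uminus[OF p] padic_cong_mult_left[OF p] padic_int_power[OF p]
        padic_int_inverse[OF p] ncm padic_cong_negative_binomial p y n)
  finally show ?thesis unfolding S .
qed

text \<open>Induction on the depth, with \<open>lo\<close> general because inner sums start at the
  current variable. Every denominator in the untranslated sum lies strictly between 0 and
  \<open>p\<close>, so it is a unit at \<open>p\<close> and the geometric-type expansion
  applies.\<close>

lemma padic_cong_hsum_shift:
  assumes p: "prime p" and c: "int p dvd c" and lo: "0 \<le> lo" and hi: "hi \<le> int p"
  shows "padic_cong n p (hsum k (c + lo) (c + hi) -
    (\<Sum>w<n. (- of_int c) ^ w * shift_sum k w (\<lambda>l. hsum l lo hi)))"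
  using lo
proof (induction k arbitrary: lo)
  case Nil
  show ?case
  proof (cases n)
    case 0
    then show ?thesis using padic_cong_of_int[OF p, of 0 1] by simp
  next
    case (Suc n')
    have "(\<Sum>w<n. (- of_int c) ^ w * shift_sum [] w (\<lambda>l. hsum l lo hi)) = (\<Sum>w<n. if w = 0 then 1 else 0 :: rat)"
      by (intro sum.cong refl) auto
    then show ?thesis using Suc padic_cong_0[OF p] by simp
  qed
next
  case (Cons k ks)
  have c0: "padic_cong 0 p (- of_int c)" and c1: "padic_cong 1 p (- of_int c)"
    using c padic_cong_of_int[OF p, of _ "- c"] by auto
  have nat0: "padic_cong 0 p (of_nat j)" for j using padic_cong_of_int[OF p, of 0 "int j"] by simp
  define A :: "int \<Rightarrow> rat" where "A = (\<lambda>m. inverse (of_int (c + m) ^ k))"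
  define B :: "int \<Rightarrow> rat" where "B = (\<lambda>m. hsum ks (c + m) (c + hi))"
  define f :: "int \<Rightarrow> nat \<Rightarrow> rat" where
    "f = (\<lambda>m w. of_nat ((k + w - 1) choose w) * (- of_int c) ^ w * inverse (of_int m ^ (k + w)))"
  define g :: "int \<Rightarrow> nat \<Rightarrow> rat" where
    "g = (\<lambda>m w. (- of_int c) ^ w * shift_sum ks w (\<lambda>l. hsum l m hi))"
  have main: "padic_cong n p (A m * B m - (\<Sum>w<n. \<Sum>v\<le>w. f m v * g m (w - v)))"
    if m: "m \<in> {lo<..<hi}" for m
  \<comment> \<open>The one-variable expansion asks for \<open>n > 0\<close>. At level 0 only
    integrality is claimed, and the induction hypothesis at level 0 gives it for the inner
    sum.\<close>
  proof (cases "n = 0")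
    case True
    have "\<not> int p dvd c + m"
      using not_dvd_between[OF p, of m] m Cons.prems hi c by (auto simp: dvd_add_right_iff)
    moreover have "padic_cong 0 p (B m)"
      using Cons.IH[of m] m Cons.prems True by (simp add: B_def)
    ultimately show ?thesis using True
      by (simp add: A_def flip: power_inverse del: of_int_add)
        (intro padic_cong_mult_left[OF p] padic_int_power[OF p] padic_int_inverse[OF p])
  next
    case False
    have m': "m \<in> {0<..<int p}" using m Cons.prems hi by auto
    have A: "padic_cong n p (A m - sum (f m) {..<n})"
      unfolding A_def f_def using False by (intro padic_cong_inverse_power_shift p m' c) auto
    have B: "padic_cong n p (B m - sum (g m) {..<n})"
      unfolding B_def g_def using m Cons.prems by (intro Cons.IH) auto
    have fw: "padic_cong w p (f m w)" for w
      unfolding f_def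
      by (subst power_inverse[symmetric], intro padic_cong_mult_right[OF p] padic_cong_mult_left[OF p] nat0
          padic_cong_power[OF p] padic_int_power[OF p] padic_int_inverse[OF p] c1 not_dvd_between[OF p] m')
    have gw: "padic_cong w p (g m w)" for w
      unfolding g_def using m' hi
      by (intro padic_cong_mult_right[OF p] padic_cong_power[OF p] c1 padic_int_shift_sum[OF p]
          padic_int_hsum[OF p]) auto
    have f0: "padic_cong 0 p (sum (f m) {..<n})"
      using padic_cong_mono[OF p fw] by (intro padic_cong_sum[OF p]) auto
    have g0: "padic_cong 0 p (sum (g m) {..<n})"
      using padic_cong_mono[OF p gw] by (intro padic_cong_sum[OF p]) auto
    have B0: "padic_cong 0 p (B m)"
      using padic_cong_add[OF p padic_cong_mono[OF p B, of 0] g0] by simp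
    \<comment> \<open>The square of pairs exceeds the Cauchy triangle by pairs with
      \<open>v + w >= n\<close>, whose products are divisible by \<open>p ^ n\<close>.\<close>
    have "sum (f m) {..<n} * sum (g m) {..<n} - (\<Sum>w<n. \<Sum>v\<le>w. f m v * g m (w - v)) =
        (\<Sum>(v, w)\<in>{(v, w). v < n \<and> w < n \<and> v + w \<ge> n}. f m v * g m w)"
    proof -
      have "(\<Sum>w<n. \<Sum>v\<le>w. f m v * g m (w - v)) =
          (\<Sum>(v, w)\<in>{(v, w). v + w < n}. f m v * g m w)"
        by (rule sum.triangle_reindex[symmetric])
      moreover have "sum (f m) {..<n} * sum (g m) {..<n} = (\<Sum>(v, w)\<in>{..<n} \<times> {..<n}. f m v * g m w)"
        by (simp add: sum_product sum.cartesian_product)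
      moreover have "(\<Sum>(v, w)\<in>{..<n} \<times> {..<n}. f m v * g m w) =
          (\<Sum>(v, w)\<in>{..<n} \<times> {..<n} - {(v, w). v + w < n}. f m v * g m w) +
          (\<Sum>(v, w)\<in>{(v, w). v + w < n}. f m v * g m w)"
        by (rule sum.subset_diff) auto
      moreover have "{..<n} \<times> {..<n} - {(v, w). v + w < n} = {(v, w). v < n \<and> w < n \<and> v + w \<ge> n}"
        by auto
      ultimately show ?thesis by simp
    qed
    moreover have "padic_cong n p (\<Sum>(v, w)\<in>{(v, w). v < n \<and> w < n \<and> v + w \<ge> n}. f m v * g m w)"
      by (rule padic_cong_sum[OF p]) (auto intro: padic_cong_mono[OF p padic_cong_mult[OF p fw gw]])
    ultimately have trunc: "padic_cong n p
        (sum (f m) {..<n} * sum (g m) {..<n} - (\<Sum>w<n. \<Sum>v\<le>w. f m v * g m (w - v)))" by simp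
    \<comment> \<open>One factor is replaced at a time; integrality of \<open>B m\<close> and of the
      sum of \<open>f m\<close> keeps both errors divisible by \<open>p ^ n\<close>.\<close>
    have "padic_cong n p ((A m - sum (f m) {..<n}) * B m + sum (f m) {..<n} * (B m - sum (g m) {..<n}) +
        (sum (f m) {..<n} * sum (g m) {..<n} - (\<Sum>w<n. \<Sum>v\<le>w. f m v * g m (w - v))))"
      by (intro padic_cong_add[OF p] trunc padic_cong_mult_right[OF p A B0] padic_cong_mult_left[OF p f0 B])
    then show ?thesis by (simp add: algebra_simps)
  qed
  have "hsum (k # ks) (c + lo) (c + hi) = (\<Sum>m\<in>{lo<..<hi}. A m * B m)"
    unfolding hsum.simps A_def B_def
    by (rule sum.reindex_bij_witness[of _ "\<lambda>m. c + m" "\<lambda>m. m - c"]) auto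
  moreover have "(\<Sum>w<n. (- of_int c) ^ w * shift_sum (k # ks) w (\<lambda>l. hsum l lo hi)) =
      (\<Sum>m\<in>{lo<..<hi}. \<Sum>w<n. \<Sum>v\<le>w. f m v * g m (w - v))"
  proof -
    have "(- of_int c) ^ w * shift_sum (k # ks) w (\<lambda>l. hsum l lo hi) =
        (\<Sum>m\<in>{lo<..<hi}. \<Sum>v\<le>w. f m v * g m (w - v))" for w
    proof -
      have pw: "(- of_int c :: rat) ^ w = (- of_int c) ^ v * (- of_int c) ^ (w - v)" if "v \<le> w" for v
        using that by (simp flip: power_add)
      have "(- of_int c) ^ w * shift_sum (k # ks) w (\<lambda>l. hsum l lo hi) =
          (\<Sum>v\<le>w. \<Sum>m\<in>{lo<..<hi}. f m v * g m (w - v))"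
        unfolding shift_sum.simps hsum.simps shift_sum_sum shift_sum_mult_left sum_distrib_left f_def g_def
        by (intro sum.cong refl) (simp only: pw atMost_iff mult_ac)
      then show ?thesis by (subst sum.swap)
    qed
    then have "(\<Sum>w<n. (- of_int c) ^ w * shift_sum (k # ks) w (\<lambda>l. hsum l lo hi)) =
        (\<Sum>w<n. \<Sum>m\<in>{lo<..<hi}. \<Sum>v\<le>w. f m v * g m (w - v))" by simp
    then show ?thesis by (subst sum.swap)
  qed
  ultimately show ?case
    by (simp only: sum_subtractf[symmetric]) (intro padic_cong_sum[OF p] main)
qed

section \<open>Comparison of the symmetric and the finite side\<close>

lemma mzvZ_prod: "(\<And>i. i \<in> A \<Longrightarrow> f i \<in> mzvZ) \<Longrightarrow> prod f A \<in> mzvZ"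
  by (induction A rule: infinite_finite_induct) (auto intro: mzvZ.mult)

lemma shift_coeff_mzvZ: "shift_coeff k m \<in> mzvZ"
  unfolding shift_coeff_def poly_0_coeff_0
  by (intro mzvZ_sum mzvZ.mult mzvZ_prod zeta_reg_mzvZ mzvZ_of_nat)

lemma zetaS2_mzvZ: "zetaS2 k u v \<in> mzvZ"
proof -
  have "(-1) ^ n \<in> mzvZ" for n using mzvZ_of_int[of "(-1) ^ n"] by simp
  then show ?thesis unfolding zetaS2_def by (intro mzvZ_sum mzvZ.mult shift_coeff_mzvZ)
qed

lemma ZT_add: "f \<in> ZT \<Longrightarrow> g \<in> ZT \<Longrightarrow> f + g \<in> ZT"
  by (auto simp: ZT_def intro: mzvZ.add)

lemma ZT_mult: "f \<in> ZT \<Longrightarrow> g \<in> ZT \<Longrightarrow> f * g \<in> ZT"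
  by (auto simp: ZT_def fps_mult_nth intro!: mzvZ_sum mzvZ.mult)

lemma ZT_diff: "f \<in> ZT \<Longrightarrow> g \<in> ZT \<Longrightarrow> f - g \<in> ZT"
  by (auto simp: ZT_def intro: mzvZ_diff)

lemma ZT_const: "c \<in> mzvZ \<Longrightarrow> fps_const c \<in> ZT"
  by (auto simp: ZT_def)

lemma ZT_X: "fps_X \<in> ZT"
  by (auto simp: ZT_def fps_X_def)

lemma ZT_shift: "f \<in> ZT \<Longrightarrow> fps_shift n f \<in> ZT"
  by (auto simp: ZT_def)

lemma ZT_subst_line:
  assumes "\<And>u v. X u v \<in> mzvZ"
  shows "subst_line X a \<in> ZT"
proof -
  have "of_int a + 1 \<in> mzvZ" by (intro mzvZ.add mzvZ_of_int mzvZ_1)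
  then show ?thesis using assms unfolding ZT_def subst_line_def
    by (auto intro!: mzvZ_sum mzvZ.mult mzvZ_power)
qed

lemma subst_line_0_nth: "fps_nth (subst_line X 0) m = X 0 m"
proof -
  have "fps_nth (subst_line X 0) m = (\<Sum>u\<le>m. if u = 0 then X 0 m else 0)"
    unfolding subst_line_def fps_nth_Abs_fps by (intro sum.cong refl) auto
  then show ?thesis by simp
qed

lemma fps_nth_shift_sum: "fps_nth (shift_sum k w F) i = shift_sum k w (\<lambda>l. fps_nth (F l) i)"
proof (induction k arbitrary: w F)
  case (Cons k ks)
  show ?case
    unfolding shift_sum.simps fps_sum_nth fps_of_nat[symmetric] fps_mult_left_const_nth Cons.IH ..
qed simp

text \<open>A finite expression in rational constants, \<open>fps_X\<close> and series at
  \<open>s = 0\<close>: precisely the ingredients whose images under \<open>per\<close> are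
  prescribed.\<close>

definition truncated_line :: "nat \<Rightarrow> nat list \<Rightarrow> int \<Rightarrow> real fps" where
  "truncated_line n k a = (\<Sum>w<n. fps_const (of_rat ((- of_int a) ^ w)) * fps_X ^ w *
     shift_sum k w (\<lambda>l. subst_line (zetaS2 l) 0))"

text \<open>The term of index \<open>w\<close> starts in degree \<open>w\<close>, so cutting at
  \<open>n\<close> loses nothing below degree \<open>n\<close>.\<close>

lemma truncated_line_nth:
  assumes "m < n"
  shows "fps_nth (truncated_line n k a) m = fps_nth (subst_line (zetaS2 k) a) m"
proof -
  have "fps_nth (truncated_line n k a) m =
      (\<Sum>w<n. if m < w then 0 else (- of_int a) ^ w * shift_sum k w (\<lambda>l. zetaS2 l 0 (m - w)))"
    unfolding truncated_line_def fps_sum_nth mult.assoc fps_mult_left_const_nth fps_X_power_mult_nth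
      fps_nth_shift_sum subst_line_0_nth
    by (intro sum.cong refl) (simp add: of_rat_power of_rat_minus)
  also have "\<dots> = (\<Sum>w\<le>m. (- of_int a) ^ w * shift_sum k w (\<lambda>l. zetaS2 l 0 (m - w)))"
    using assms by (intro sum.mono_neutral_cong_right) auto
  also have "\<dots> = fps_nth (subst_line (zetaS2 k) a) m"
    by (simp add: subst_line_def zetaS2_line_shift)
  finally show ?thesis .
qed

section \<open>Congruences at all large primes and equality of representatives\<close>

definition padic_ev :: "nat \<Rightarrow> (nat \<Rightarrow> rat) \<Rightarrow> bool" where
  "padic_ev n f \<longleftrightarrow> eventually (\<lambda>p. prime p \<longrightarrow> padic_cong n p (f p)) sequentially"

lemma padic_ev_add:
  assumes "padic_ev n f" "padic_ev n g"
  shows "padic_ev n (\<lambda>p. f p + g p)"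
  using assms unfolding padic_ev_def by eventually_elim (auto intro: padic_cong_add)

lemma padic_ev_diff:
  assumes "padic_ev n f" "padic_ev n g"
  shows "padic_ev n (\<lambda>p. f p - g p)"
  using assms unfolding padic_ev_def by eventually_elim (auto intro: padic_cong_diff)

lemma padic_ev_mult_left:
  assumes "padic_ev 0 f" "padic_ev n g"
  shows "padic_ev n (\<lambda>p. f p * g p)"
  using assms unfolding padic_ev_def by eventually_elim (auto intro: padic_cong_mult_left)

lemma padic_ev_mult_right:
  assumes "padic_ev n f" "padic_ev 0 g"
  shows "padic_ev n (\<lambda>p. f p * g p)"
  using assms unfolding padic_ev_def by eventually_elim (auto intro: padic_cong_mult_right)

lemma padic_ev_0_mono:
  assumes "padic_ev n f"
  shows "padic_ev 0 f"
  using assms unfolding padic_ev_def by eventually_elim (auto intro: padic_cong_mono)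

lemma ahat_eq_iff: "ahat_eq x y \<longleftrightarrow> (\<forall>n. padic_ev n (\<lambda>p. x n p - y n p))"
  by (simp add: ahat_eq_def padic_ev_def)

lemma ahat_eq_refl: "ahat_eq x x"
  by (auto simp: ahat_eq_def)

lemma ahat_eq_sym: "ahat_eq x y \<Longrightarrow> ahat_eq y x"
  unfolding ahat_eq_iff
proof
  fix n assume xy: "\<forall>n. padic_ev n (\<lambda>p. x n p - y n p)"
  have "padic_ev n (\<lambda>p. 0)" by (simp add: padic_ev_def)
  then have "padic_ev n (\<lambda>p. 0 - (x n p - y n p))" by (rule padic_ev_diff[OF _ spec[OF xy]])
  then show "padic_ev n (\<lambda>p. y n p - x n p)" by simp
qed

lemma ahat_eq_trans: "ahat_eq x y \<Longrightarrow> ahat_eq y z \<Longrightarrow> ahat_eq x z"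
  unfolding ahat_eq_iff
proof
  fix n assume xy: "\<forall>n. padic_ev n (\<lambda>p. x n p - y n p)" and yz: "\<forall>n. padic_ev n (\<lambda>p. y n p - z n p)"
  have "padic_ev n (\<lambda>p. (x n p - y n p) + (y n p - z n p))" by (rule padic_ev_add[OF spec[OF xy] spec[OF yz]])
  then show "padic_ev n (\<lambda>p. x n p - z n p)" by simp
qed

lemma ahat_eq_add: "ahat_eq x x' \<Longrightarrow> ahat_eq y y' \<Longrightarrow> ahat_eq (ahat_add x y) (ahat_add x' y')"
  unfolding ahat_eq_iff
proof
  fix n assume x: "\<forall>n. padic_ev n (\<lambda>p. x n p - x' n p)" and y: "\<forall>n. padic_ev n (\<lambda>p. y n p - y' n p)"
  have "padic_ev n (\<lambda>p. (x n p - x' n p) + (y n p - y' n p))" by (rule padic_ev_add[OF spec[OF x] spec[OF y]])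
  then show "padic_ev n (\<lambda>p. ahat_add x y n p - ahat_add x' y' n p)" by (simp add: ahat_add_def algebra_simps)
qed

text \<open>Representatives are arbitrary rationals, and \<open>ahat_mul\<close> respects
  \<open>ahat_eq\<close> only under integrality at almost all primes. Unlike
  \<open>ahat_elem\<close>, this asks for no compatibility between levels.\<close>

definition ahat_int :: "ahat \<Rightarrow> bool" where
  "ahat_int x \<longleftrightarrow> (\<forall>n. padic_ev 0 (x n))"

lemma ahat_int_cong: "ahat_eq x y \<Longrightarrow> ahat_int x \<Longrightarrow> ahat_int y"
  unfolding ahat_int_def ahat_eq_iff
proof
  fix n assume xy: "\<forall>n. padic_ev n (\<lambda>p. x n p - y n p)" and x: "\<forall>n. padic_ev 0 (x n)"
  have "padic_ev 0 (\<lambda>p. x n p - (x n p - y n p))"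
    by (rule padic_ev_diff[OF spec[OF x] padic_ev_0_mono[OF spec[OF xy]]])
  then show "padic_ev 0 (y n)" by simp
qed

lemma ahat_elem_int: "ahat_elem x \<Longrightarrow> ahat_int x"
  unfolding ahat_elem_def ahat_int_def padic_ev_def
proof
  fix n
  assume "\<forall>n. eventually (\<lambda>p. prime p \<longrightarrow>
      padic_cong 0 p (x n p) \<and> padic_cong n p (x (Suc n) p - x n p)) sequentially"
  from spec[OF this, of n] show "eventually (\<lambda>p. prime p \<longrightarrow> padic_cong 0 p (x n p)) sequentially"
    by eventually_elim simp
qed

lemma ahat_eq_mult:
  assumes "ahat_eq x x'" "ahat_eq y y'" "ahat_int x" "ahat_int y"
  shows "ahat_eq (ahat_mul x y) (ahat_mul x' y')"
  unfolding ahat_eq_iff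
proof
  fix n
  have "padic_ev 0 (x' n)" using ahat_int_cong[OF assms(1,3)] by (simp add: ahat_int_def)
  moreover have "padic_ev 0 (y n)" using assms(4) by (simp add: ahat_int_def)
  moreover have "padic_ev n (\<lambda>p. x n p - x' n p)" "padic_ev n (\<lambda>p. y n p - y' n p)"
    using assms(1,2) by (simp_all add: ahat_eq_iff)
  ultimately have "padic_ev n (\<lambda>p. (x n p - x' n p) * y n p + x' n p * (y n p - y' n p))"
    by (intro padic_ev_add[OF padic_ev_mult_right padic_ev_mult_left])
  then show "padic_ev n (\<lambda>p. ahat_mul x y n p - ahat_mul x' y' n p)"
    by (simp add: ahat_mul_def algebra_simps)
qed

section \<open>Transport of finite expressions through \<open>per\<close>\<close>

context
  fixes per :: "real fps \<Rightarrow> ahat"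
  assumes per: "is_per per"
begin

lemma
  shows per_ZAhat: "f \<in> ZT \<Longrightarrow> per f \<in> ZAhat"
    and per_eq_iff: "f \<in> ZT \<Longrightarrow> g \<in> ZT \<Longrightarrow> ahat_eq (per f) (per g) \<longleftrightarrow> ts_eq f g"
    and per_add: "f \<in> ZT \<Longrightarrow> g \<in> ZT \<Longrightarrow> ahat_eq (per (f + g)) (ahat_add (per f) (per g))"
    and per_mult: "f \<in> ZT \<Longrightarrow> g \<in> ZT \<Longrightarrow> ahat_eq (per (f * g)) (ahat_mul (per f) (per g))"
    and per_const: "ahat_eq (per (fps_const (of_rat q))) (ahat_const q)"
    and per_X: "ahat_eq (per fps_X) ahat_p"
    and per_zeta: "is_index k \<Longrightarrow> ahat_eq (per (subst_line (zetaS2 k) 0)) (zetaA k 0)"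
proof -
  note conjs = per[unfolded is_per_def]
  have "\<forall>f\<in>ZT. per f \<in> ZAhat" using conjs by (elim conjE)
  then show "f \<in> ZT \<Longrightarrow> per f \<in> ZAhat" by (rule bspec)
  have "\<forall>f\<in>ZT. \<forall>g\<in>ZT. ahat_eq (per f) (per g) \<longleftrightarrow> ts_eq f g" using conjs by (elim conjE)
  then show "f \<in> ZT \<Longrightarrow> g \<in> ZT \<Longrightarrow> ahat_eq (per f) (per g) \<longleftrightarrow> ts_eq f g" by blast
  have "\<forall>f\<in>ZT. \<forall>g\<in>ZT. ahat_eq (per (f + g)) (ahat_add (per f) (per g))" using conjs by (elim conjE)
  then show "f \<in> ZT \<Longrightarrow> g \<in> ZT \<Longrightarrow> ahat_eq (per (f + g)) (ahat_add (per f) (per g))" by blast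
  have "\<forall>f\<in>ZT. \<forall>g\<in>ZT. ahat_eq (per (f * g)) (ahat_mul (per f) (per g))" using conjs by (elim conjE)
  then show "f \<in> ZT \<Longrightarrow> g \<in> ZT \<Longrightarrow> ahat_eq (per (f * g)) (ahat_mul (per f) (per g))" by blast
  have "\<forall>q. ahat_eq (per (fps_const (of_rat q))) (ahat_const q)" using conjs by (elim conjE)
  then show "ahat_eq (per (fps_const (of_rat q))) (ahat_const q)" by (rule spec)
  show "ahat_eq (per fps_X) ahat_p" using conjs by (elim conjE)
  have "\<forall>k. is_index k \<longrightarrow> ahat_eq (per (subst_line (zetaS2 k) 0)) (zetaA k 0)" using conjs by (elim conjE)
  then show "is_index k \<Longrightarrow> ahat_eq (per (subst_line (zetaS2 k) 0)) (zetaA k 0)" by blast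
qed

lemma per_int: "f \<in> ZT \<Longrightarrow> ahat_int (per f)"
  using per_ZAhat unfolding ZAhat_def by (auto intro: ahat_elem_int)

definition per_rel :: "real fps \<Rightarrow> ahat \<Rightarrow> bool" where
  "per_rel f x \<longleftrightarrow> f \<in> ZT \<and> ahat_eq (per f) x"

lemma per_rel_add:
  assumes "per_rel f x" "per_rel g y"
  shows "per_rel (f + g) (\<lambda>n p. x n p + y n p)"
proof -
  have fg: "f \<in> ZT" "g \<in> ZT" and xy: "ahat_eq (per f) x" "ahat_eq (per g) y"
    using assms by (simp_all add: per_rel_def)
  show ?thesis
    unfolding per_rel_def ahat_add_def[symmetric]
    using ZT_add[OF fg] ahat_eq_trans[OF per_add[OF fg] ahat_eq_add[OF xy]] ..
qed

lemma per_rel_mult: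
  assumes "per_rel f x" "per_rel g y"
  shows "per_rel (f * g) (\<lambda>n p. x n p * y n p)"
proof -
  have fg: "f \<in> ZT" "g \<in> ZT" and xy: "ahat_eq (per f) x" "ahat_eq (per g) y"
    using assms by (simp_all add: per_rel_def)
  show ?thesis
    unfolding per_rel_def ahat_mul_def[symmetric]
    using ZT_mult[OF fg] ahat_eq_trans[OF per_mult[OF fg] ahat_eq_mult[OF xy per_int per_int, OF fg]] ..
qed

lemma per_rel_const: "per_rel (fps_const (of_rat q)) (\<lambda>n p. q)"
  unfolding per_rel_def using per_const[of q] by (auto simp: ahat_const_def intro: ZT_const mzvZ.rat)

lemma per_rel_X: "per_rel fps_X (\<lambda>n p. of_nat p)"
  unfolding per_rel_def using per_X by (auto simp: ahat_p_def intro: ZT_X)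

lemma per_rel_zeta: "is_index k \<Longrightarrow> per_rel (subst_line (zetaS2 k) 0) (\<lambda>n p. hsum k 0 (int p))"
  unfolding per_rel_def using per_zeta by (auto simp: zetaA_def[abs_def] intro: ZT_subst_line zetaS2_mzvZ)

lemma per_rel_of_nat: "per_rel (of_nat j) (\<lambda>n p. of_nat j)"
  using per_rel_const[of "of_nat j"] by (simp add: fps_of_nat)

lemma per_rel_power: "per_rel f x \<Longrightarrow> per_rel (f ^ j) (\<lambda>n p. x n p ^ j)"
proof (induction j)
  case 0
  then show ?case using per_rel_of_nat[of 1] by simp
qed (auto intro: per_rel_mult)

lemma per_rel_sum: "(\<And>i. i \<in> A \<Longrightarrow> per_rel (f i) (x i)) \<Longrightarrow> per_rel (sum f A) (\<lambda>n p. \<Sum>i\<in>A. x i n p)"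
proof (induction A rule: infinite_finite_induct)
  case (insert i A)
  then show ?case using per_rel_add[of "f i" "x i" "sum f A"] by simp
qed (use per_rel_of_nat[of 0] in simp_all)

lemma per_rel_shift_sum:
  assumes "is_index k" "\<And>l. is_index l \<Longrightarrow> per_rel (F l) (x l)"
  shows "per_rel (shift_sum k w F) (\<lambda>n p. shift_sum k w (\<lambda>l. x l n p))"
  using assms
proof (induction k arbitrary: w F x)
  case Nil
  then show ?case using per_rel_of_nat[of 0] by simp
next
  case (Cons k ks)
  show ?case unfolding shift_sum.simps
    by (intro per_rel_sum per_rel_mult per_rel_of_nat Cons.IH Cons.prems(2)) (use Cons.prems(1) in auto)
qed

lemma per_rel_truncated_line:
  assumes "is_index k"
  shows "per_rel (truncated_line n k a)
    (\<lambda>m p. \<Sum>w<n. (- of_int a) ^ w * of_nat p ^ w * shift_sum k w (\<lambda>l. hsum l 0 (int p)))"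
  unfolding truncated_line_def
  by (intro per_rel_sum per_rel_mult per_rel_const per_rel_power per_rel_X per_rel_shift_sum assms per_rel_zeta)

text \<open>At level \<open>n\<close> the series and its truncation differ by a multiple of
  \<open>t^n\<close>, whose image vanishes modulo \<open>p^n\<close>; on the truncation,
  \<open>per\<close> gives the expansion of the translated sum.\<close>

lemma per_subst_line:
  assumes k: "is_index k"
  shows "ahat_eq (per (subst_line (zetaS2 k) a)) (zetaA k a)"
  unfolding ahat_eq_iff
proof
  fix n
  define f where "f = subst_line (zetaS2 k) a"
  \<comment> \<open>The quotient of the difference by \<open>t^n\<close>; dividing is legitimate
    because the first \<open>n\<close> coefficients agree.\<close>
  define h where "h = fps_shift n (f - truncated_line n k a)"
  define x :: "nat \<Rightarrow> rat" where
    "x = (\<lambda>p. \<Sum>w<n. (- of_int a) ^ w * of_nat p ^ w * shift_sum k w (\<lambda>l. hsum l 0 (int p)))"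
  have tl: "per_rel (truncated_line n k a) (\<lambda>m p. x p)"
    unfolding x_def by (rule per_rel_truncated_line[OF k])
  have h: "h \<in> ZT"
    using tl unfolding h_def f_def per_rel_def by (intro ZT_shift ZT_diff ZT_subst_line zetaS2_mzvZ) auto
  have "f - truncated_line n k a = fps_X ^ n * h"
    unfolding h_def by (rule fps_ext) (auto simp: fps_X_power_mult_nth f_def truncated_line_nth)
  then have f: "f = truncated_line n k a + fps_X ^ n * h" by (simp add: algebra_simps)
  have "per_rel f (\<lambda>m p. x p + of_nat p ^ n * per h m p)"
    unfolding f using h
    by (intro per_rel_add tl per_rel_mult per_rel_power per_rel_X) (simp add: per_rel_def ahat_eq_refl)
  then have 1: "padic_ev n (\<lambda>p. per f n p - (x p + of_nat p ^ n * per h n p))"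
    by (simp add: per_rel_def ahat_eq_iff)
  have "padic_cong n p (of_nat p ^ n)" if "prime p" for p
    using padic_cong_of_int[OF that, of n "int p ^ n"] by simp
  then have "padic_ev n (\<lambda>p. of_nat p ^ n)"
    unfolding padic_ev_def by (intro always_eventually) simp
  then have 2: "padic_ev n (\<lambda>p. of_nat p ^ n * per h n p)"
    using per_int[OF h] by (intro padic_ev_mult_right) (simp_all add: ahat_int_def)
  have "padic_cong n p (zetaA k a n p - x p)" if "prime p" for p
  proof -
    have "x p = (\<Sum>w<n. (- of_int (a * int p)) ^ w * shift_sum k w (\<lambda>l. hsum l 0 (int p)))"
      unfolding x_def by (rule sum.cong[OF refl]) (simp flip: power_mult_distrib)
    moreover have "zetaA k a n p = hsum k (a * int p + 0) (a * int p + int p)"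
      by (simp add: zetaA_def distrib_right)
    ultimately show ?thesis
      using padic_cong_hsum_shift[OF that, of "a * int p" 0 "int p" n k] by simp
  qed
  then have 3: "padic_ev n (\<lambda>p. zetaA k a n p - x p)"
    unfolding padic_ev_def by (intro always_eventually) simp
  have "padic_ev n (\<lambda>p. per f n p - (x p + of_nat p ^ n * per h n p) + of_nat p ^ n * per h n p - (zetaA k a n p - x p))"
    by (rule padic_ev_diff[OF padic_ev_add[OF 1 2] 3])
  then show "padic_ev n (\<lambda>p. per (subst_line (zetaS2 k) a) n p - zetaA k a n p)"
    by (simp add: f_def)
qed

end

section \<open>Uniqueness of the two-variable series\<close>

lemma poly_coeffs_in_rat_subspace:
  fixes p :: "real poly" and V :: "real set" and S :: "rat set"
  assumes add: "\<And>x y. x \<in> V \<Longrightarrow> y \<in> V \<Longrightarrow> x + y \<in> V"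
    and scale: "\<And>q x. x \<in> V \<Longrightarrow> of_rat q * x \<in> V"
    and "infinite S" and "\<And>x. x \<in> S \<Longrightarrow> poly p (of_rat x) \<in> V"
  shows "coeff p i \<in> V"
  using assms(3,4)
proof (induction "degree p" arbitrary: p S i)
  have nonempty: "\<exists>y. y \<in> S" if "infinite S" for S :: "rat set" using that by (metis ex_in_conv finite.emptyI)
  case 0
  then obtain c where c: "p = [:c:]" by (metis degree_eq_zeroE)
  obtain y where "y \<in> S" using nonempty[OF 0(2)] by blast
  then have "c \<in> V" using 0(3) c by auto
  then show ?case using scale[of c 0] c by (auto simp: coeff_pCons split: nat.split)
next
  case (Suc d)
  obtain y where y: "y \<in> S" using Suc.prems(1) by (metis ex_in_conv finite.emptyI)
  \<comment> \<open>As in Newton interpolation: the divided differences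
    \<open>(p(x) - p(y)) / (x - y)\<close> have rational denominators, so \<open>q\<close> takes
    values in \<open>V\<close> at the remaining points.\<close>
  define q where "q = synthetic_div p (of_rat y)"
  have p: "p = [:- of_rat y, 1:] * q + [:poly p (of_rat y):]"
    unfolding q_def by (rule synthetic_div_correct'[symmetric])
  have diff: "u - v \<in> V" if "u \<in> V" "v \<in> V" for u v
    using add[OF that(1) scale[OF that(2), of "-1"]] by simp
  have q: "coeff q j \<in> V" for j
  proof (rule Suc.hyps(1)[of q "S - {y}"])
    show "d = degree q" using Suc.hyps(2) by (simp add: q_def degree_synthetic_div)
    show "infinite (S - {y})" using Suc.prems(1) by simp
    fix x assume x: "x \<in> S - {y}"
    have "poly p (of_rat x) - poly p (of_rat y) = (of_rat x - of_rat y) * poly q (of_rat x)"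
      by (subst p) (simp add: algebra_simps)
    moreover have "(of_rat x :: real) \<noteq> of_rat y" using x by simp
    ultimately have "poly q (of_rat x) = of_rat (inverse (x - y)) * (poly p (of_rat x) - poly p (of_rat y))"
      using x by (simp add: of_rat_inverse of_rat_diff)
    then show "poly q (of_rat x) \<in> V"
      using Suc.prems(2) x y by (auto intro!: scale diff)
  qed
  have py: "poly p (of_rat y) \<in> V" using Suc.prems(2) y by blast
  have V0: "0 \<in> V" using scale[OF py, of 0] by simp
  have "coeff p i = (case i of 0 \<Rightarrow> 0 | Suc j \<Rightarrow> coeff q j) - of_rat y * coeff q i + (if i = 0 then poly p (of_rat y) else 0)"
    by (subst p) (auto simp: coeff_pCons algebra_simps split: nat.split)
  also have "\<dots> \<in> V" using q V0 py by (intro add diff scale) (auto split: nat.split)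
  finally show ?case .
qed

text \<open>The coefficient of \<open>t^m\<close> on a line is a form of degree \<open>m\<close> in
  \<open>a\<close> and \<open>a + 1\<close>. Dividing by \<open>(a + 1) ^ m\<close> turns it into a
  polynomial at \<open>a / (a + 1)\<close>. Its values lie in \<open>z2Z\<close>, which is used only
  as a rational subspace.\<close>

lemma zcong_if_zcong_on_lines:
  assumes "\<And>a. ts_eq (subst_line X a) (subst_line Y a)"
  shows "zcong (X u v) (Y u v)"
proof -
  define m where "m = u + v"
  define D where "D = (\<lambda>u. X u (m - u) - Y u (m - u))"
  define p where "p = (\<Sum>u\<le>m. monom (D u) u)"
  have z2Z_add: "x + y \<in> z2Z" if "x \<in> z2Z" "y \<in> z2Z" for x y
  proof -
    obtain x' y' where "x = mzv [2] * x'" "x' \<in> mzvZ" "y = mzv [2] * y'" "y' \<in> mzvZ"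
      using \<open>x \<in> z2Z\<close> \<open>y \<in> z2Z\<close> unfolding z2Z_def by blast
    then have "x + y = mzv [2] * (x' + y')" "x' + y' \<in> mzvZ" by (auto simp: distrib_left intro: mzvZ.add)
    then show ?thesis unfolding z2Z_def by blast
  qed
  have z2Z_scale: "of_rat q * x \<in> z2Z" if "x \<in> z2Z" for q x
  proof -
    obtain x' where "x = mzv [2] * x'" "x' \<in> mzvZ" using \<open>x \<in> z2Z\<close> unfolding z2Z_def by blast
    then have "of_rat q * x = mzv [2] * (of_rat q * x')" "of_rat q * x' \<in> mzvZ"
      by (auto intro: mzvZ.mult mzvZ.rat)
    then show ?thesis unfolding z2Z_def by blast
  qed
  \<comment> \<open>The parameters \<open>a / (a + 1)\<close> for natural \<open>a\<close>:
    infinitely many distinct rationals, and the denominator never vanishes.\<close>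
  define r :: "nat \<Rightarrow> rat" where "r = (\<lambda>n. of_nat n / of_nat (Suc n))"
  have "inj r"
  proof (rule injI)
    fix i j assume "r i = r j"
    then have "of_nat i * of_nat (Suc j) = (of_nat j * of_nat (Suc i) :: rat)"
      by (simp add: r_def frac_eq_eq del: of_nat_Suc)
    then have "i * Suc j = j * Suc i" by (simp only: of_nat_mult[symmetric] of_nat_eq_iff)
    then show "i = j" by simp
  qed
  then have inf: "infinite (range r)" by (rule range_inj_infinite)
  have "poly p (of_rat x) \<in> z2Z" if "x \<in> range r" for x
  proof -
    obtain n where x: "x = r n" using \<open>x \<in> range r\<close> by blast
    have "(\<Sum>u\<le>m. D u * of_nat n ^ u * of_nat (Suc n) ^ (m - u)) =
        fps_nth (subst_line X (int n)) m - fps_nth (subst_line Y (int n)) m"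
      by (simp add: subst_line_def D_def algebra_simps sum_subtractf)
    also have "\<dots> \<in> z2Z" using assms by (simp add: ts_eq_def zcong_def)
    finally have *: "(\<Sum>u\<le>m. D u * of_nat n ^ u * of_nat (Suc n) ^ (m - u)) \<in> z2Z" .
    have "poly p (of_rat x) = (\<Sum>u\<le>m. D u * (of_nat n / of_nat (Suc n)) ^ u)"
      by (simp add: p_def poly_sum poly_monom x r_def of_rat_divide of_rat_add)
    also have "\<dots> = of_rat (inverse (of_nat (Suc n) ^ m)) *
        (\<Sum>u\<le>m. D u * of_nat n ^ u * of_nat (Suc n) ^ (m - u))"
      unfolding sum_distrib_left
    proof (rule sum.cong[OF refl])
      have inv: "(of_rat (inverse (of_nat (Suc n) ^ m)) :: real) = inverse (real (Suc n) ^ m)"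
        by (simp only: of_rat_inverse of_rat_power of_rat_of_nat_eq)
      fix u assume "u \<in> {..m}"
      then have "real (Suc n) ^ m = real (Suc n) ^ u * real (Suc n) ^ (m - u)" by (simp flip: power_add)
      then show "D u * (real n / real (Suc n)) ^ u = of_rat (inverse (of_nat (Suc n) ^ m)) *
          (D u * real n ^ u * real (Suc n) ^ (m - u))"
        unfolding inv by (simp add: power_divide field_simps del: of_nat_Suc)
    qed
    also have "\<dots> \<in> z2Z" by (intro z2Z_scale *)
    finally show ?thesis .
  qed
  then have "coeff p u \<in> z2Z"
    by (intro poly_coeffs_in_rat_subspace[OF _ _ inf]) (auto intro: z2Z_add z2Z_scale)
  moreover have "coeff p u = D u"
    by (simp add: p_def coeff_sum m_def)
  ultimately show ?thesis by (simp add: D_def m_def zcong_def)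
qed

theorem theorem7p3:
  fixes per :: "real fps \<Rightarrow> ahat"
  assumes "is_per per"
  shows "\<forall>k. is_index k \<longrightarrow>
           (\<forall>a::int. ahat_eq (per (subst_line (zetaS2 k) a)) (zetaA k a))
         \<and> (\<forall>X :: nat \<Rightarrow> nat \<Rightarrow> real. (\<forall>u v. X u v \<in> mzvZ) \<longrightarrow>
              (\<forall>a::int. ahat_eq (per (subst_line X a)) (zetaA k a)) \<longrightarrow>
              (\<forall>u v. zcong (X u v) (zetaS2 k u v)))"
proof (intro allI impI conjI)
  fix k a assume "is_index k"
  then show "ahat_eq (per (subst_line (zetaS2 k) a)) (zetaA k a)"
    by (rule per_subst_line[OF assms])
next
  fix k X u v
  assume k: "is_index k" and X: "\<forall>u v. X u v \<in> mzvZ"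
    and eq: "\<forall>a. ahat_eq (per (subst_line X a)) (zetaA k a)"
  show "zcong (X u v) (zetaS2 k u v)"
  proof (rule zcong_if_zcong_on_lines)
    fix a
    \<comment> \<open>Both series have the same image on every line, so injectivity of
      \<open>per\<close> modulo \<open>z2Z\<close> applies.\<close>
    have "ahat_eq (per (subst_line X a)) (per (subst_line (zetaS2 k) a))"
      using eq by (blast intro: ahat_eq_trans ahat_eq_sym per_subst_line[OF assms k])
    then show "ts_eq (subst_line X a) (subst_line (zetaS2 k) a)"
      using X by (subst (asm) per_eq_iff[OF assms]) (auto intro: ZT_subst_line zetaS2_mzvZ)
  qed
qed

end
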